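(* If the posets $(\mathrm{AP}_{\mathcal S},\le_{\mathcal S})$ and $(\mathrm{Ap}_1,\le_1)$ are isomorphic, then $\beta_i(k[\mathcal C])=\beta_i(k[\mathcal C_1])$ for all $i$.
   Context: Let $k$ be an infinite field, $d\ge 1$, and $0=a_0<a_1<\dots<a_n=d$ integers with $\gcd(a_1,\dots,a_n)=1$. Put $\mathbf a_i=(a_i,d-a_i)$. Let $\mathcal S_1\subseteq\mathbb N$ be the numerical semigroup generated by $a_1,\dots,a_n$ and $\mathcal S\subseteq\mathbb N^2$ the monoid generated by $\mathbf a_0,\dots,\mathbf a_n$. Partial orders: $y\le_1 z$ iff $z-y\in\mathcal S_1$; $\mathbf y\le_{\mathcal S}\mathbf z$ iff $\mathbf z-\mathbf y\in\mathcal S$. $\mathrm{Ap}_1=\{y\in\mathcal S_1:y-d\notin\mathcal S_1\}$, $\mathrm{AP}_{\mathcal S}=\{\mathbf y\in\mathcal S:\mathbf y-\mathbf a_0\notin\mathcal S,\ \mathbf y-\mathbf a_n\notin\mathcal S\}$, with induced orders. $k[\mathcal C]=k[x_0,\dots,x_n]/I_{\mathcal A}$ where $I_{\mathcal A}$ is the kernel of $x_i\mapsto u^{a_i}v^{d-a_i}$; $k[\mathcal C_1]=k[x_1,\dots,x_n]/I_{\mathcal A_1}$ where $I_{\mathcal A_1}$ is the kernel of $x_i\mapsto t^{a_i}$. $\beta_i$ denotes the $i$-th Betti number, i.e. the rank of the $i$-th free module in a minimal graded free resolution over the respective polynomial ring. *)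

theory Defs
  imports "HOL-Library.Poly_Mapping"
begin

text \<open>A polynomial is a finitely supported map from monomials (exponent vectors
  \<open>nat \<Rightarrow>\<^sub>0 nat\<close>, variable index to exponent) to coefficients.  Multiplication is
  the convolution product of HOL-Library.Poly_Mapping.\<close>

type_synonym 'k mpoly = "(nat \<Rightarrow>\<^sub>0 nat) \<Rightarrow>\<^sub>0 'k"

definition Pring :: "nat set \<Rightarrow> 'k::field mpoly set" where
  "Pring V = {p :: 'k mpoly. \<forall>m \<in> Poly_Mapping.keys p. Poly_Mapping.keys m \<subseteq> V}"

definition wdeg :: "(nat \<Rightarrow> nat) \<Rightarrow> (nat \<Rightarrow>\<^sub>0 nat) \<Rightarrow> int" where
  "wdeg w m = int (\<Sum>j\<in>Poly_Mapping.keys m. Poly_Mapping.lookup m j * w j)"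

definition homogeneous :: "(nat \<Rightarrow> nat) \<Rightarrow> int \<Rightarrow> 'k::field mpoly \<Rightarrow> bool" where
  "homogeneous w \<delta> p \<longleftrightarrow> (\<forall>m \<in> Poly_Mapping.keys p. wdeg w m = \<delta>)"

definition in_max_ideal :: "'k::field mpoly \<Rightarrow> bool" where
  "in_max_ideal p \<longleftrightarrow> Poly_Mapping.lookup p 0 = 0"

definition free_mod :: "nat set \<Rightarrow> nat \<Rightarrow> (nat \<Rightarrow> 'k::field mpoly) set" where
  "free_mod V b = {v. (\<forall>j<b. v j \<in> Pring V) \<and> (\<forall>j\<ge>b. v j = 0)}"

definition matvec :: "(nat \<Rightarrow> nat \<Rightarrow> 'k::field mpoly) \<Rightarrow> nat \<Rightarrow> nat \<Rightarrow> (nat \<Rightarrow> 'k mpoly) \<Rightarrow> (nat \<Rightarrow> 'k mpoly)" where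
  "matvec M rows cols v = (\<lambda>r. if r < rows then (\<Sum>c<cols. M r c * v c) else 0)"

text \<open>
  \<open>min_graded_free_res w V I b sh e d\<close>: a minimal graded free resolution
  \<open>\<dots> \<rightarrow> F_2 \<rightarrow> F_1 \<rightarrow> F_0 \<rightarrow> S/I \<rightarrow> 0\<close> over \<open>S = Pring V\<close> (grading by weights \<open>w\<close>),
  where \<open>F_i = \<Oplus>_{j<b i} S(-sh i j)\<close>, the map \<open>d i : F_i \<rightarrow> F_(i-1)\<close> (for \<open>i \<ge> 1\<close>) is
  given by the matrix \<open>d i\<close> (entry \<open>d i r c\<close> = component \<open>r\<close> of the image of basis
  vector \<open>c\<close>), and the augmentation \<open>F_0 \<rightarrow> S/I\<close> sends basis vector \<open>j\<close> to the class
  of \<open>e j\<close>.  Maps are homogeneous of degree 0, the sequence is exact, and minimality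
  means \<open>d i (F_i) \<subseteq> m F_(i-1)\<close>, i.e. all matrix entries lie in the homogeneous
  maximal ideal.\<close>
definition min_graded_free_res ::
  "(nat \<Rightarrow> nat) \<Rightarrow> nat set \<Rightarrow> 'k::field mpoly set \<Rightarrow> (nat \<Rightarrow> nat) \<Rightarrow> (nat \<Rightarrow> nat \<Rightarrow> int)
     \<Rightarrow> (nat \<Rightarrow> 'k mpoly) \<Rightarrow> (nat \<Rightarrow> nat \<Rightarrow> nat \<Rightarrow> 'k mpoly) \<Rightarrow> bool" where
  "min_graded_free_res w V I b sh e d \<longleftrightarrow>
     \<comment> \<open>augmentation: entries in S, homogeneous of the right degree\<close>
     (\<forall>j<b 0. e j \<in> Pring V \<and> homogeneous w (sh 0 j) (e j)) \<and>
     \<comment> \<open>differentials: entries in S, graded of degree 0, minimal\<close>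
     (\<forall>i\<ge>1. \<forall>r<b (i-1). \<forall>c<b i.
        d i r c \<in> Pring V \<and> homogeneous w (sh i c - sh (i-1) r) (d i r c)
        \<and> in_max_ideal (d i r c)) \<and>
     \<comment> \<open>augmentation is surjective onto S/I\<close>
     (\<forall>f \<in> Pring V. \<exists>v \<in> free_mod V (b 0). (\<Sum>j<b 0. e j * v j) - f \<in> I) \<and>
     \<comment> \<open>exactness at F_0\<close>
     {v \<in> free_mod V (b 0). (\<Sum>j<b 0. e j * v j) \<in> I}
        = matvec (d 1) (b 0) (b 1) ` free_mod V (b 1) \<and>
     \<comment> \<open>exactness at F_i, i >= 1\<close>
     (\<forall>i\<ge>1. {v \<in> free_mod V (b i). matvec (d i) (b (i-1)) (b i) v = (\<lambda>_. 0)}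
        = matvec (d (Suc i)) (b i) (b (Suc i)) ` free_mod V (b (Suc i)))"

text \<open>The \<open>i\<close>-th Betti number of \<open>S/I\<close>: the rank of \<open>F_i\<close> in a minimal graded free
  resolution (independent of the choice of resolution).\<close>
definition betti :: "(nat \<Rightarrow> nat) \<Rightarrow> nat set \<Rightarrow> 'k::field mpoly set \<Rightarrow> nat \<Rightarrow> nat" where
  "betti w V I i = (THE r. \<exists>b sh e d. min_graded_free_res w V I b sh e d \<and> b i = r)"

text \<open>Substitution of monomials: \<open>x^m \<mapsto> u^(\<Sum> m_i a_i) v^(\<Sum> m_i (d - a_i))\<close>
  (variables \<open>u,v\<close> indexed 0, 1) resp. \<open>x^m \<mapsto> t^(\<Sum> m_i a_i)\<close> (variable \<open>t\<close> indexed 0).\<close>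
definition mon_img :: "(nat \<Rightarrow> nat) \<Rightarrow> nat \<Rightarrow> (nat \<Rightarrow>\<^sub>0 nat) \<Rightarrow> (nat \<Rightarrow>\<^sub>0 nat)" where
  "mon_img a d m = Poly_Mapping.single 0 (\<Sum>i\<in>Poly_Mapping.keys m. Poly_Mapping.lookup m i * a i)
                 + Poly_Mapping.single 1 (\<Sum>i\<in>Poly_Mapping.keys m. Poly_Mapping.lookup m i * (d - a i))"

definition mon_img1 :: "(nat \<Rightarrow> nat) \<Rightarrow> (nat \<Rightarrow>\<^sub>0 nat) \<Rightarrow> (nat \<Rightarrow>\<^sub>0 nat)" where
  "mon_img1 a m = Poly_Mapping.single 0 (\<Sum>i\<in>Poly_Mapping.keys m. Poly_Mapping.lookup m i * a i)"

definition subst_mon :: "((nat \<Rightarrow>\<^sub>0 nat) \<Rightarrow> (nat \<Rightarrow>\<^sub>0 nat)) \<Rightarrow> 'k::field mpoly \<Rightarrow> 'k mpoly" where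
  "subst_mon \<phi> p = (\<Sum>m\<in>Poly_Mapping.keys p. Poly_Mapping.single (\<phi> m) (Poly_Mapping.lookup p m))"

definition toric_ideal :: "(nat \<Rightarrow> nat) \<Rightarrow> nat \<Rightarrow> nat \<Rightarrow> 'k::field mpoly set" where
  "toric_ideal a d n = {p \<in> Pring {0..n}. subst_mon (mon_img a d) p = 0}"

definition toric_ideal1 :: "(nat \<Rightarrow> nat) \<Rightarrow> nat \<Rightarrow> 'k::field mpoly set" where
  "toric_ideal1 a n = {p \<in> Pring {1..n}. subst_mon (mon_img1 a) p = 0}"

definition S1 :: "(nat \<Rightarrow> nat) \<Rightarrow> nat \<Rightarrow> nat set" where
  "S1 a n = {y. \<exists>c::nat \<Rightarrow> nat. y = (\<Sum>i\<in>{1..n}. c i * a i)}"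

definition SS :: "(nat \<Rightarrow> nat) \<Rightarrow> nat \<Rightarrow> nat \<Rightarrow> (nat \<times> nat) set" where
  "SS a d n = {((\<Sum>i\<in>{0..n}. c i * a i), (\<Sum>i\<in>{0..n}. c i * (d - a i))) | c::nat \<Rightarrow> nat. True}"

text \<open>\<open>y \<le>_1 z\<close> iff \<open>z - y \<in> S_1\<close> (difference taken in \<open>\<int>\<close>).\<close>
definition le1 :: "(nat \<Rightarrow> nat) \<Rightarrow> nat \<Rightarrow> nat \<Rightarrow> nat \<Rightarrow> bool" where
  "le1 a n y z \<longleftrightarrow> y \<le> z \<and> z - y \<in> S1 a n"

text \<open>\<open>y \<le>_S z\<close> iff \<open>z - y \<in> S\<close> (difference taken in \<open>\<int>\<^sup>2\<close>).\<close>
definition leS :: "(nat \<Rightarrow> nat) \<Rightarrow> nat \<Rightarrow> nat \<Rightarrow> nat \<times> nat \<Rightarrow> nat \<times> nat \<Rightarrow> bool" where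
  "leS a d n y z \<longleftrightarrow> fst y \<le> fst z \<and> snd y \<le> snd z
                     \<and> (fst z - fst y, snd z - snd y) \<in> SS a d n"

definition Ap1 :: "(nat \<Rightarrow> nat) \<Rightarrow> nat \<Rightarrow> nat \<Rightarrow> nat set" where
  "Ap1 a d n = {y \<in> S1 a n. \<not> (d \<le> y \<and> y - d \<in> S1 a n)}"

text \<open>\<open>AP_S = {y \<in> S : y - a_0 \<notin> S, y - a_n \<notin> S}\<close>, \<open>a_0 = (0,d)\<close>, \<open>a_n = (d,0)\<close>.\<close>
definition APS :: "(nat \<Rightarrow> nat) \<Rightarrow> nat \<Rightarrow> nat \<Rightarrow> (nat \<times> nat) set" where
  "APS a d n = {y \<in> SS a d n.
      \<not> (d \<le> snd y \<and> (fst y, snd y - d) \<in> SS a d n) \<and>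
      \<not> (d \<le> fst y \<and> (fst y - d, snd y) \<in> SS a d n)}"

definition poset_iso :: "'a set \<Rightarrow> ('a \<Rightarrow> 'a \<Rightarrow> bool) \<Rightarrow> 'b set \<Rightarrow> ('b \<Rightarrow> 'b \<Rightarrow> bool) \<Rightarrow> bool" where
  "poset_iso A leA B leB \<longleftrightarrow>
     (\<exists>f. bij_betw f A B \<and> (\<forall>x\<in>A. \<forall>y\<in>A. leA x y \<longleftrightarrow> leB (f x) (f y)))"

end

(* The isomorphism forces the first projection AP_S -> Ap_1 to be an isomorphism of posets: it has a
   section, so equal cardinality makes it bijective, and it preserves the order, so the equal number
   of comparable pairs makes it reflect the order.  Bijectivity yields the Cohen-Macaulay property, so
   x_0, x_n is a regular sequence on k[C], while x_n is regular on k[C_1].  A monomial in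
   x_1, ..., x_(n-1) lies over AP_S iff it lies over Ap_1, with the same coincidences among images, so
   setting x_0, x_n (resp. x_n) to zero turns both toric ideals into the same ideal of
   k[x_1, ..., x_(n-1)].  Reduction modulo a regular variable maps a minimal free resolution to a
   minimal free resolution with the same ranks, and these ranks are unique, even without gradings,
   so the two gradings need not be compared. *)

theory Submission
  imports Defs Complex_Main "HOL-Library.Function_Algebras" "HOL-Library.Product_Lexorder"
begin

text \<open>\<open>betti\<close> is a definite description, so either side has a value only once a
  minimal graded free resolution is constructed and its ranks are shown unique. Existence iterates
  minimal generating sets of graded syzygy modules, producing an infinite sequence with no claim
  about where it becomes zero. Quotient rings are avoided throughout. A toric ideal consists of the
  polynomials whose coefficients sum to zero over every fibre of a monomial map, and setting a
  variable to zero deletes the conditions at those fibres that contain a multiple of the variable.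
  Every ideal that occurs is thus given by a set of surviving target monomials, and a variable is
  regular as soon as this set is stable under translation by the image of the variable. The delicate
  case is x_n after x_0 has been set to zero: if s lies in the semigroup and s - a_0 does not, then
  s + a_n - a_0 must not lie in it either. This holds because an element of AP_S is determined by
  its first coordinate, and that coordinate by its residue modulo d.\<close>

abbreviation (input) "lookup \<equiv> Poly_Mapping.lookup"
abbreviation (input) "keys \<equiv> Poly_Mapping.keys"
abbreviation (input) "single \<equiv> Poly_Mapping.single"

section \<open>Polynomials\<close>

lemma poly_mapping_sum_single:
  "p = (\<Sum>m\<in>keys p. single m (lookup p m))"
proof (rule poly_mapping_eqI)
  fix k
  have "lookup (\<Sum>m\<in>keys p. single m (lookup p m)) k = (\<Sum>m\<in>keys p. if m = k then lookup p k else 0)"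
    by (auto simp: lookup_sum lookup_single when_def intro!: sum.cong)
  also have "\<dots> = lookup p k" by (simp add: in_keys_iff)
  finally show "lookup p k = lookup (\<Sum>m\<in>keys p. single m (lookup p m)) k" by simp
qed

lemma keys_add_nat: "keys (m + m' :: nat \<Rightarrow>\<^sub>0 nat) = keys m \<union> keys m'"
  by (auto simp: in_keys_iff lookup_add)

lemma Pring_iff: "p \<in> Pring V \<longleftrightarrow> (\<forall>m. lookup p m \<noteq> 0 \<longrightarrow> keys m \<subseteq> V)"
  by (auto simp: Pring_def in_keys_iff)

lemma Pring_zero [simp]: "0 \<in> Pring V"
  by (simp add: Pring_def)

lemma Pring_one [simp]: "1 \<in> Pring V"
  by (simp add: Pring_def)

lemma Pring_add [intro]: "p \<in> Pring V \<Longrightarrow> q \<in> Pring V \<Longrightarrow> p + q \<in> Pring V"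
  using keys_add[of p q] by (fastforce simp: Pring_def)

lemma Pring_uminus [intro]: "p \<in> Pring V \<Longrightarrow> - p \<in> Pring V"
  by (simp add: Pring_iff)

lemma Pring_diff [intro]: "p \<in> Pring V \<Longrightarrow> q \<in> Pring V \<Longrightarrow> p - q \<in> Pring V"
  using Pring_add[OF _ Pring_uminus, of p V q] by simp

lemma Pring_mult [intro]: "p \<in> Pring V \<Longrightarrow> q \<in> Pring V \<Longrightarrow> p * q \<in> Pring V"
  unfolding Pring_def using keys_mult[of p q] by (fastforce simp: keys_add_nat)

lemma Pring_sum [intro]: "(\<And>i. i \<in> A \<Longrightarrow> f i \<in> Pring V) \<Longrightarrow> sum f A \<in> Pring V"
  by (induction A rule: infinite_finite_induct) auto

lemma Pring_single: "keys m \<subseteq> V \<Longrightarrow> single m c \<in> Pring V"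
  by (auto simp: Pring_def)

lemma Pring_mono: "V \<subseteq> W \<Longrightarrow> p \<in> Pring V \<Longrightarrow> p \<in> Pring W"
  by (auto simp: Pring_def)

text \<open>One operation for three uses: the constant term (\<open>m = 0\<close>), setting a
  variable to zero (\<open>rho\<close>), and homogeneous components (\<open>hc\<close>).\<close>

definition pfilter :: "('a \<Rightarrow> bool) \<Rightarrow> ('a \<Rightarrow>\<^sub>0 'b) \<Rightarrow> ('a \<Rightarrow>\<^sub>0 'b::zero)" where
  "pfilter P p = Poly_Mapping.mapp (\<lambda>m c. if P m then c else 0) p"

lemma lookup_pfilter: "lookup (pfilter P p) m = (if P m then lookup p m else 0)"
  by (auto simp: pfilter_def lookup_mapp when_def in_keys_iff)

lemma keys_pfilter: "keys (pfilter P p) = {m \<in> keys p. P m}"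
  by (auto simp: in_keys_iff lookup_pfilter split: if_splits)

lemma pfilter_zero [simp]: "pfilter P 0 = 0"
  by (rule poly_mapping_eqI) (simp add: lookup_pfilter)

lemma pfilter_add: "pfilter P (p + q) = pfilter P p + pfilter P q"
  by (rule poly_mapping_eqI) (simp add: lookup_pfilter lookup_add)

lemma pfilter_diff:
  "pfilter P (p - q) = pfilter P p - (pfilter P q :: 'a \<Rightarrow>\<^sub>0 'b::ab_group_add)"
  by (rule poly_mapping_eqI) (simp add: lookup_pfilter lookup_minus)

lemma pfilter_sum: "pfilter P (sum f A) = (\<Sum>i\<in>A. pfilter P (f i))"
  by (rule poly_mapping_eqI) (simp add: lookup_pfilter lookup_sum)

lemma pfilter_single: "pfilter P (single m c) = (if P m then single m c else 0)"
  by (rule poly_mapping_eqI) (auto simp: lookup_pfilter lookup_single when_def)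

lemma pfilter_True: "(\<And>m. m \<in> keys p \<Longrightarrow> P m) \<Longrightarrow> pfilter P p = p"
  by (rule poly_mapping_eqI) (auto simp: lookup_pfilter in_keys_iff)

lemma pfilter_expand:
  fixes p :: "'a \<Rightarrow>\<^sub>0 'b::comm_monoid_add"
  shows "pfilter P p = (\<Sum>m\<in>keys p. if P m then single m (lookup p m) else 0)"
proof -
  have "pfilter P p = pfilter P (\<Sum>m\<in>keys p. single m (lookup p m))"
    by (rule arg_cong[OF poly_mapping_sum_single])
  then show ?thesis by (simp add: pfilter_sum pfilter_single)
qed

text \<open>Three separate predicates let one computation give both the multiplicativity of
  \<open>rho\<close> (all three equal) and the degree shift in \<open>hc_mult_homogeneous\<close>,
  where \<open>P\<close> is constantly true.\<close>

lemma pfilter_mult: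
  fixes p q :: "'a::monoid_add \<Rightarrow>\<^sub>0 'b::semiring_0"
  assumes "\<And>m m'. m \<in> keys p \<Longrightarrow> m' \<in> keys q \<Longrightarrow> R (m + m') \<longleftrightarrow> P m \<and> Q m'"
  shows "pfilter R (p * q) = pfilter P p * pfilter Q q"
proof -
  have "p * q = (\<Sum>m\<in>keys p. \<Sum>m'\<in>keys q. single (m + m') (lookup p m * lookup q m'))"
    by (subst (1) poly_mapping_sum_single, subst (3) poly_mapping_sum_single) (simp add: sum_product mult_single)
  then have "pfilter R (p * q) = (\<Sum>m\<in>keys p. \<Sum>m'\<in>keys q.
      if R (m + m') then single (m + m') (lookup p m * lookup q m') else 0)"
    by (simp add: pfilter_sum pfilter_single)
  also have "\<dots> = (\<Sum>m\<in>keys p. \<Sum>m'\<in>keys q.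
      (if P m then single m (lookup p m) else 0) * (if Q m' then single m' (lookup q m') else 0))"
    using assms by (intro sum.cong refl) (auto simp: mult_single)
  also have "\<dots> = pfilter P p * pfilter Q q"
    by (simp add: pfilter_expand sum_product)
  finally show ?thesis .
qed

text \<open>Exponents are natural numbers, so a product of monomials is trivial only if both factors
  are. The constant term is therefore a ring homomorphism to the residue field, which carries the
  comparison of ranks.\<close>

lemma lookup_mult_zero:
  fixes p q :: "(nat \<Rightarrow>\<^sub>0 nat) \<Rightarrow>\<^sub>0 'k::semiring_0"
  shows "lookup (p * q) 0 = lookup p 0 * lookup q 0"
proof -
  have *: "m + m' = 0 \<longleftrightarrow> m = 0 \<and> m' = 0" for m m' :: "nat \<Rightarrow>\<^sub>0 nat"
    by (auto simp: poly_mapping_eq_iff fun_eq_iff lookup_add)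
  have c: "pfilter (\<lambda>m. m = 0) r = single 0 (lookup r 0)" for r :: "(nat \<Rightarrow>\<^sub>0 nat) \<Rightarrow>\<^sub>0 'k"
    by (rule poly_mapping_eqI) (auto simp: lookup_pfilter lookup_single when_def)
  have "pfilter (\<lambda>m. m = 0) (p * q) = pfilter (\<lambda>m. m = 0) p * pfilter (\<lambda>m. m = 0) q"
    by (rule pfilter_mult) (simp add: *)
  then have "single 0 (lookup (p * q) 0) = single (0::nat \<Rightarrow>\<^sub>0 nat) (lookup p 0 * lookup q 0)"
    by (simp only: c mult_single) simp
  then show ?thesis by (metis lookup_single_eq)
qed

lemma Pring_pfilter [intro]: "p \<in> Pring V \<Longrightarrow> pfilter P p \<in> Pring V"
  by (auto simp: Pring_def keys_pfilter)

section \<open>Free modules and linear maps\<close>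

definition smul :: "'a::times \<Rightarrow> ('i \<Rightarrow> 'a) \<Rightarrow> 'i \<Rightarrow> 'a" where
  "smul s v = (\<lambda>r. s * v r)"

definition unit_vec :: "nat \<Rightarrow> nat \<Rightarrow> 'a::zero_neq_one" where
  "unit_vec c = (\<lambda>r. if r = c then 1 else 0)"

text \<open>Comparison maps and homotopies are kept as functions that are constrained only on
  \<open>free_mod V b\<close>; composing them is then plain function composition, with no matrix
  products.\<close>

definition lin :: "nat set \<Rightarrow> nat \<Rightarrow> nat \<Rightarrow> ((nat \<Rightarrow> 'k::field mpoly) \<Rightarrow> nat \<Rightarrow> 'k mpoly) \<Rightarrow> bool" where
  "lin V b c f \<longleftrightarrow> (\<forall>v\<in>free_mod V b. f v \<in> free_mod V c \<and>
     (\<forall>w\<in>free_mod V b. f (v + w) = f v + f w) \<and> (\<forall>s\<in>Pring V. f (smul s v) = smul s (f v)))"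

lemma sum_fun_apply: "(\<Sum>i\<in>A. f i) r = (\<Sum>i\<in>A. f i (r::'b))" for f :: "'a \<Rightarrow> 'b \<Rightarrow> 'c::comm_monoid_add"
  by (induction A rule: infinite_finite_induct) auto

lemma free_mod_zero [simp]: "0 \<in> free_mod V b"
  by (simp add: free_mod_def)

lemma free_mod_zero' [simp]: "(\<lambda>_. 0) \<in> free_mod V b"
  by (simp add: free_mod_def)

lemma free_mod_add [intro]: "v \<in> free_mod V b \<Longrightarrow> w \<in> free_mod V b \<Longrightarrow> v + w \<in> free_mod V b"
  by (auto simp: free_mod_def)

lemma free_mod_smul [intro]: "s \<in> Pring V \<Longrightarrow> v \<in> free_mod V b \<Longrightarrow> smul s v \<in> free_mod V b"
  by (auto simp: free_mod_def smul_def)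

lemma free_mod_diff [intro]: "v \<in> free_mod V b \<Longrightarrow> w \<in> free_mod V b \<Longrightarrow> v - w \<in> free_mod V b"
  by (auto simp: free_mod_def)

lemma free_mod_sum [intro]: "(\<And>i. i \<in> A \<Longrightarrow> f i \<in> free_mod V b) \<Longrightarrow> sum f A \<in> free_mod V b"
  by (induction A rule: infinite_finite_induct) auto

lemma free_mod_unit [intro]: "c < b \<Longrightarrow> unit_vec c \<in> free_mod V b"
  by (auto simp: free_mod_def unit_vec_def)

lemma free_mod_Pring: "v \<in> free_mod V b \<Longrightarrow> v r \<in> Pring V"
  by (cases "r < b") (auto simp: free_mod_def)

lemma free_mod_ge: "v \<in> free_mod V b \<Longrightarrow> r \<ge> b \<Longrightarrow> v r = 0"
  by (auto simp: free_mod_def)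

lemma free_mod_expand:
  assumes "v \<in> free_mod V b"
  shows "v = (\<Sum>c<b. smul (v c) (unit_vec c))"
proof
  fix r
  have "(\<Sum>c<b. smul (v c) (unit_vec c)) r = (\<Sum>c<b. if c = r then v r else 0)"
    unfolding sum_fun_apply by (rule sum.cong) (auto simp: smul_def unit_vec_def)
  then show "v r = (\<Sum>c<b. smul (v c) (unit_vec c)) r"
    using free_mod_ge[OF assms] by simp
qed

lemma smul_add_left: "smul (s + t) v = smul s v + smul t (v :: 'i \<Rightarrow> 'a::semiring)"
  by (auto simp: smul_def distrib_right)

lemma smul_smul: "smul s (smul t v) = smul (s * t) (v :: 'i \<Rightarrow> 'a::semigroup_mult)"
  by (auto simp: smul_def mult.assoc)

lemma smul_diff_right: "smul s (v - w) = smul s v - smul s (w :: 'i \<Rightarrow> 'a::ring)"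
  by (auto simp: smul_def right_diff_distrib)

lemma smul_zero_left [simp]: "smul 0 v = (0 :: 'i \<Rightarrow> 'a::semiring_0)"
  by (auto simp: smul_def)

lemma smul_one [simp]: "smul 1 v = (v :: 'i \<Rightarrow> 'a::monoid_mult)"
  by (auto simp: smul_def)

lemma smul_minus_one: "smul (- 1) v = (- v :: 'i \<Rightarrow> 'a::ring_1)"
  by (auto simp: smul_def)

lemma smul_sum: "smul s (sum f A) = (\<Sum>i\<in>A. smul s (f i :: 'i \<Rightarrow> 'a::semiring_0))"
  by (auto simp: smul_def sum_fun_apply sum_distrib_left)

lemma linD:
  assumes "lin V b c f"
  shows "\<And>v. v \<in> free_mod V b \<Longrightarrow> f v \<in> free_mod V c"
    and "\<And>v w. v \<in> free_mod V b \<Longrightarrow> w \<in> free_mod V b \<Longrightarrow> f (v + w) = f v + f w"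
    and "\<And>s v. s \<in> Pring V \<Longrightarrow> v \<in> free_mod V b \<Longrightarrow> f (smul s v) = smul s (f v)"
  using assms by (auto simp: lin_def)

lemma lin_zero: "lin V b c f \<Longrightarrow> f 0 = 0"
  using linD(3)[of V b c f 0 0] by simp

lemma lin_diff:
  assumes "lin V b c f" "v \<in> free_mod V b" "w \<in> free_mod V b"
  shows "f (v - w) = f v - f w"
  using linD(2)[OF assms(1) free_mod_diff[OF assms(2,3)] assms(3)] by (simp add: algebra_simps)

lemma lin_sum:
  assumes "lin V b c f" "\<And>i. i \<in> A \<Longrightarrow> s i \<in> Pring V" "\<And>i. i \<in> A \<Longrightarrow> v i \<in> free_mod V b"
  shows "f (\<Sum>i\<in>A. smul (s i) (v i)) = (\<Sum>i\<in>A. smul (s i) (f (v i)))"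
  using assms(2,3)
proof (induction A rule: infinite_finite_induct)
  case (insert x A)
  then have "(\<Sum>i\<in>A. smul (s i) (v i)) \<in> free_mod V b" "smul (s x) (v x) \<in> free_mod V b" by blast+
  then have "f (smul (s x) (v x) + (\<Sum>i\<in>A. smul (s i) (v i))) = smul (s x) (f (v x)) + f (\<Sum>i\<in>A. smul (s i) (v i))"
    using linD(2,3)[OF assms(1)] insert.prems by simp
  moreover have "f (\<Sum>i\<in>A. smul (s i) (v i)) = (\<Sum>i\<in>A. smul (s i) (f (v i)))"
    using insert.IH insert.prems by blast
  ultimately show ?case by (simp only: sum.insert[OF insert.hyps])
qed (auto simp: lin_zero[OF assms(1)])

lemma lin_expand:
  assumes "lin V b c f" "v \<in> free_mod V b"
  shows "f v = (\<Sum>j<b. smul (v j) (f (unit_vec j)))"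
proof -
  have "f v = f (\<Sum>j<b. smul (v j) (unit_vec j))"
    by (rule arg_cong[OF free_mod_expand[OF assms(2)]])
  also have "\<dots> = (\<Sum>j<b. smul (v j) (f (unit_vec j)))"
    by (rule lin_sum[OF assms(1)]) (auto intro: free_mod_Pring[OF assms(2)])
  finally show ?thesis .
qed

lemma lin_comb:
  assumes "\<And>j. j < b \<Longrightarrow> u j \<in> free_mod V c"
  shows "lin V b c (\<lambda>v. \<Sum>j<b. smul (v j) (u j))"
  unfolding lin_def
proof (intro ballI conjI)
  fix v :: "nat \<Rightarrow> 'a mpoly" assume v: "v \<in> free_mod V b"
  show "(\<Sum>j<b. smul (v j) (u j)) \<in> free_mod V c"
    by (intro free_mod_sum free_mod_smul free_mod_Pring[OF v] assms) simp
  show "(\<Sum>j<b. smul ((v + w) j) (u j)) = (\<Sum>j<b. smul (v j) (u j)) + (\<Sum>j<b. smul (w j) (u j))" for w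
    by (simp only: plus_fun_apply smul_add_left sum.distrib)
  show "(\<Sum>j<b. smul (smul s v j) (u j)) = smul s (\<Sum>j<b. smul (v j) (u j))" for s
    by (simp only: smul_sum smul_smul) (simp add: smul_def)
qed

lemma lin_id: "lin V b b (\<lambda>v. v)"
  by (auto simp: lin_def)

lemma lin_compose: "lin V b c f \<Longrightarrow> lin V c d g \<Longrightarrow> lin V b d (\<lambda>v. g (f v))"
  by (simp add: lin_def)

lemma lin_minus: "lin V b c f \<Longrightarrow> lin V b c g \<Longrightarrow> lin V b c (\<lambda>v. f v - g v)"
  by (auto simp: lin_def smul_diff_right algebra_simps)

lemma lin_matvec:
  assumes "\<And>r c. r < p \<Longrightarrow> c < q \<Longrightarrow> M r c \<in> Pring V"
  shows "lin V q p (matvec M p q)"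
  unfolding lin_def
proof (intro ballI conjI)
  fix v :: "nat \<Rightarrow> 'a mpoly" assume v: "v \<in> free_mod V q"
  show "matvec M p q v \<in> free_mod V p"
    using assms free_mod_Pring[OF v] by (auto simp: free_mod_def matvec_def intro!: Pring_sum Pring_mult)
  show "matvec M p q (v + w) = matvec M p q v + matvec M p q w" for w
    by (rule ext) (simp add: matvec_def distrib_left sum.distrib)
  show "matvec M p q (smul s v) = smul s (matvec M p q v)" for s
    by (rule ext) (simp add: matvec_def smul_def sum_distrib_left mult.left_commute)
qed

text \<open>Free modules are projective: one preimage under \<open>D\<close> is chosen for the image
  of each \<open>unit_vec j\<close>, and linear extension gives \<open>h\<close>.\<close>

lemma lin_lift:
  assumes D: "lin V p q D" and g: "lin V b q g"
    and im: "\<And>v. v \<in> free_mod V b \<Longrightarrow> g v \<in> D ` free_mod V p"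
  obtains h where "lin V b p h" "\<And>v. v \<in> free_mod V b \<Longrightarrow> D (h v) = g v"
proof -
  have "\<exists>x. x \<in> free_mod V p \<and> D x = g (unit_vec j)" if "j < b" for j
    using im[OF free_mod_unit[OF that]] by auto
  then have "\<exists>u. \<forall>j<b. u j \<in> free_mod V p \<and> D (u j) = g (unit_vec j)"
    by meson
  then obtain u where u: "\<And>j. j < b \<Longrightarrow> u j \<in> free_mod V p" "\<And>j. j < b \<Longrightarrow> D (u j) = g (unit_vec j)"
    by blast
  show ?thesis
  proof (rule that)
    show "lin V b p (\<lambda>v. \<Sum>j<b. smul (v j) (u j))" using u(1) by (rule lin_comb)
  next
    fix v :: "nat \<Rightarrow> 'a mpoly" assume v: "v \<in> free_mod V b"
    have "D (\<Sum>j<b. smul (v j) (u j)) = (\<Sum>j<b. smul (v j) (D (u j)))"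
      by (rule lin_sum[OF D]) (auto intro: free_mod_Pring[OF v] u)
    also have "\<dots> = g v" using lin_expand[OF g v] u by simp
    finally show "D (\<Sum>j<b. smul (v j) (u j)) = g v" .
  qed
qed

definition max_vec :: "(nat \<Rightarrow> 'k::field mpoly) \<Rightarrow> bool" where
  "max_vec v \<longleftrightarrow> (\<forall>r. in_max_ideal (v r))"

lemma in_max_ideal_sum: "(\<And>i. i \<in> A \<Longrightarrow> in_max_ideal (f i)) \<Longrightarrow> in_max_ideal (sum f A)"
  by (simp add: in_max_ideal_def lookup_sum)

lemma in_max_ideal_mult: "in_max_ideal p \<or> in_max_ideal q \<Longrightarrow> in_max_ideal (p * q)"
  by (auto simp: in_max_ideal_def lookup_mult_zero)

lemma max_vec_lin:
  assumes "lin V b c f" "v \<in> free_mod V b" "max_vec v"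
  shows "max_vec (f v)"
  using assms(3) unfolding lin_expand[OF assms(1,2)] max_vec_def
  by (auto simp: sum_fun_apply smul_def intro!: in_max_ideal_sum in_max_ideal_mult)

lemma max_vec_matvec:
  assumes "\<And>r c. r < p \<Longrightarrow> c < q \<Longrightarrow> in_max_ideal (M r c)"
  shows "max_vec (matvec M p q v)"
  using assms by (auto simp: max_vec_def matvec_def in_max_ideal_def lookup_sum lookup_mult_zero)

section \<open>Uniqueness of minimal free resolutions\<close>

text \<open>Gaussian elimination by induction on the rows. A zero row is dropped; otherwise a pivot
  column \<open>c0\<close> removes one row and one column, which keeps the strict inequality of
  cardinalities, and the pivot unknown is recovered from row \<open>r0\<close>.\<close>

lemma homogeneous_system_nontrivial:
  fixes A :: "'r \<Rightarrow> 'c \<Rightarrow> 'k::field"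
  assumes "finite R" "finite C" "card R < card C"
  shows "\<exists>x. (\<forall>r\<in>R. (\<Sum>c\<in>C. A r c * x c) = 0) \<and> (\<exists>c\<in>C. x c \<noteq> 0)"
  using assms
proof (induction R arbitrary: A C rule: finite_induct)
  case empty
  then have "C \<noteq> {}" by auto
  then show ?case by (auto intro!: exI[of _ "\<lambda>_. 1"])
next
  case (insert r0 R)
  show ?case
  proof (cases "\<forall>c\<in>C. A r0 c = 0")
    case True
    then show ?thesis using insert.IH[of C A] insert.prems insert.hyps by auto
  next
    case False
    then obtain c0 where c0: "c0 \<in> C" "A r0 c0 \<noteq> 0" by blast
    define C' where "C' = C - {c0}"
    have C': "finite C'" "c0 \<notin> C'" "C = insert c0 C'" "card R < card C'"
      using c0 insert.prems insert.hyps by (auto simp: C'_def)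
    obtain x where x: "\<And>r. r \<in> R \<Longrightarrow> (\<Sum>c\<in>C'. (A r c - A r c0 * A r0 c / A r0 c0) * x c) = 0"
      and nz: "\<exists>c\<in>C'. x c \<noteq> 0"
      using insert.IH[OF C'(1,4), of "\<lambda>r c. A r c - A r c0 * A r0 c / A r0 c0"] by blast
    define t where "t = (\<Sum>c\<in>C'. A r0 c * x c)"
    define y where "y = x(c0 := - t / A r0 c0)"
    have s: "(\<Sum>c\<in>C. A r c * y c) = A r c0 * (- t / A r0 c0) + (\<Sum>c\<in>C'. A r c * x c)" for r
      using C' by (auto simp: y_def intro!: sum.cong)
    have "(\<Sum>c\<in>C. A r c * y c) = 0" if "r \<in> R" for r
    proof -
      have "0 = (\<Sum>c\<in>C'. A r c * x c - A r c0 / A r0 c0 * (A r0 c * x c))"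
        using x[OF that] by (simp add: algebra_simps)
      also have "\<dots> = (\<Sum>c\<in>C'. A r c * x c) - A r c0 / A r0 c0 * t"
        by (simp add: sum_subtractf sum_distrib_left t_def)
      finally show ?thesis by (simp add: s)
    qed
    moreover have "(\<Sum>c\<in>C. A r0 c * y c) = 0" using c0 by (simp add: s t_def)
    moreover have "\<exists>c\<in>C. y c \<noteq> 0" using nz C' by (auto simp: y_def)
    ultimately show ?thesis by blast
  qed
qed

definition is_ideal :: "nat set \<Rightarrow> 'k::field mpoly set \<Rightarrow> bool" where
  "is_ideal V I \<longleftrightarrow> I \<subseteq> Pring V \<and> 0 \<in> I \<and> (\<forall>f\<in>I. \<forall>g\<in>I. f + g \<in> I) \<and> (\<forall>s\<in>Pring V. \<forall>f\<in>I. s * f \<in> I)"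

lemma is_idealD:
  assumes "is_ideal V I"
  shows "\<And>f. f \<in> I \<Longrightarrow> f \<in> Pring V" "0 \<in> I" "\<And>f g. f \<in> I \<Longrightarrow> g \<in> I \<Longrightarrow> f + g \<in> I"
    "\<And>s f. s \<in> Pring V \<Longrightarrow> f \<in> I \<Longrightarrow> s * f \<in> I" "\<And>f g. f \<in> I \<Longrightarrow> g \<in> I \<Longrightarrow> f - g \<in> I"
proof -
  show 1: "\<And>f. f \<in> I \<Longrightarrow> f \<in> Pring V" "0 \<in> I" "\<And>f g. f \<in> I \<Longrightarrow> g \<in> I \<Longrightarrow> f + g \<in> I"
    "\<And>s f. s \<in> Pring V \<Longrightarrow> f \<in> I \<Longrightarrow> s * f \<in> I"
    using assms by (auto simp: is_ideal_def)
  fix f g assume "f \<in> I" "g \<in> I"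
  then show "f - g \<in> I" using 1(3)[of f "- 1 * g"] 1(4)[of "- 1" g] Pring_uminus[OF Pring_one] by fastforce
qed

lemma is_ideal_sum: "is_ideal V I \<Longrightarrow> (\<And>i. i \<in> A \<Longrightarrow> f i \<in> I) \<Longrightarrow> sum f A \<in> I"
  by (induction A rule: infinite_finite_induct) (auto simp: is_idealD)

text \<open>Weights and shifts are forgotten, so resolutions that come from different gradings
  satisfy one and the same predicate. Differentials are indexed by \<open>Suc i\<close> to avoid the
  truncated \<open>i - 1\<close>.\<close>

definition min_free_res ::
  "nat set \<Rightarrow> 'k::field mpoly set \<Rightarrow> (nat \<Rightarrow> nat) \<Rightarrow> (nat \<Rightarrow> 'k mpoly) \<Rightarrow> (nat \<Rightarrow> nat \<Rightarrow> nat \<Rightarrow> 'k mpoly) \<Rightarrow> bool" where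
  "min_free_res V I b e d \<longleftrightarrow>
     (\<forall>j<b 0. e j \<in> Pring V) \<and>
     (\<forall>i. \<forall>r<b i. \<forall>c<b (Suc i). d (Suc i) r c \<in> Pring V \<and> in_max_ideal (d (Suc i) r c)) \<and>
     (\<forall>f \<in> Pring V. \<exists>v \<in> free_mod V (b 0). (\<Sum>j<b 0. e j * v j) - f \<in> I) \<and>
     {v \<in> free_mod V (b 0). (\<Sum>j<b 0. e j * v j) \<in> I}
        = matvec (d 1) (b 0) (b 1) ` free_mod V (b 1) \<and>
     (\<forall>i. {v \<in> free_mod V (b (Suc i)). matvec (d (Suc i)) (b i) (b (Suc i)) v = (\<lambda>_. 0)}
        = matvec (d (Suc (Suc i))) (b (Suc i)) (b (Suc (Suc i))) ` free_mod V (b (Suc (Suc i))))"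

lemma min_free_res_of_graded:
  assumes "min_graded_free_res w V I b sh e d"
  shows "min_free_res V I b e d"
proof -
  have *: "(\<forall>i\<ge>1. P i) \<longleftrightarrow> (\<forall>i. P (Suc i))" for P :: "nat \<Rightarrow> bool"
    by (metis One_nat_def Suc_le_D Suc_le_mono le0)
  show ?thesis
    using assms unfolding min_graded_free_res_def min_free_res_def * by simp
qed

definition aug :: "(nat \<Rightarrow> nat) \<Rightarrow> (nat \<Rightarrow> 'k::field mpoly) \<Rightarrow> (nat \<Rightarrow> 'k mpoly) \<Rightarrow> 'k mpoly" where
  "aug b e v = (\<Sum>j<b 0. e j * v j)"

text \<open>The quotient \<open>S/I\<close> is never formed: at index 0 the kernel of the
  augmentation is membership in \<open>I\<close>. With this convention exactness reads the same at
  every index, and inductions on \<open>i\<close> have a uniform statement.\<close>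

fun cycles :: "nat set \<Rightarrow> 'k::field mpoly set \<Rightarrow> (nat \<Rightarrow> nat) \<Rightarrow> (nat \<Rightarrow> 'k mpoly) \<Rightarrow>
    (nat \<Rightarrow> nat \<Rightarrow> nat \<Rightarrow> 'k mpoly) \<Rightarrow> nat \<Rightarrow> (nat \<Rightarrow> 'k mpoly) set" where
  "cycles V I b e d 0 = {v \<in> free_mod V (b 0). aug b e v \<in> I}"
| "cycles V I b e d (Suc i) = {v \<in> free_mod V (b (Suc i)). matvec (d (Suc i)) (b i) (b (Suc i)) v = 0}"

lemma min_free_res_iff:
  "min_free_res V I b e d \<longleftrightarrow>
     (\<forall>j<b 0. e j \<in> Pring V) \<and>
     (\<forall>i. \<forall>r<b i. \<forall>c<b (Suc i). d (Suc i) r c \<in> Pring V \<and> in_max_ideal (d (Suc i) r c)) \<and>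
     (\<forall>f \<in> Pring V. \<exists>v \<in> free_mod V (b 0). aug b e v - f \<in> I) \<and>
     (\<forall>i. cycles V I b e d i = matvec (d (Suc i)) (b i) (b (Suc i)) ` free_mod V (b (Suc i)))"
  (is "_ \<longleftrightarrow> ?A \<and> ?B \<and> ?C \<and> ?D")
proof -
  have "?D \<longleftrightarrow> cycles V I b e d 0 = matvec (d 1) (b 0) (b 1) ` free_mod V (b 1) \<and>
    (\<forall>i. cycles V I b e d (Suc i) = matvec (d (Suc (Suc i))) (b (Suc i)) (b (Suc (Suc i))) ` free_mod V (b (Suc (Suc i))))"
    by (metis One_nat_def not0_implies_Suc)
  then show ?thesis
    unfolding min_free_res_def by (simp add: aug_def zero_fun_def)
qed

lemma aug_diff: "aug b e (v - w) = aug b e v - aug b e w"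
  by (simp add: aug_def right_diff_distrib sum_subtractf)

lemma aug_smul: "aug b e (smul s v) = s * aug b e v"
  by (simp add: aug_def smul_def sum_distrib_left mult.left_commute)

lemma aug_sum: "aug b e (sum f A) = (\<Sum>i\<in>A. aug b e (f i))"
  by (simp add: aug_def sum_fun_apply sum_distrib_left) (rule sum.swap)

lemma aug_Pring:
  "(\<And>j. j < b 0 \<Longrightarrow> e j \<in> Pring V) \<Longrightarrow> v \<in> free_mod V (b 0) \<Longrightarrow> aug b e v \<in> Pring V"
  unfolding aug_def by (intro Pring_sum Pring_mult) (auto simp: free_mod_Pring)

text \<open>Lifts the identity of \<open>S/I\<close> to the free modules at index 0. Surjectivity
  modulo \<open>I\<close> supplies the images of the basis vectors, so compatibility with the
  augmentations holds only up to elements of \<open>I\<close>.\<close>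

lemma aug_lift:
  assumes I: "is_ideal V I" and e: "\<And>j. j < b 0 \<Longrightarrow> e j \<in> Pring V"
    and surj: "\<And>f. f \<in> Pring V \<Longrightarrow> \<exists>v \<in> free_mod V (b' 0). aug b' e' v - f \<in> I"
  obtains h where "lin V (b 0) (b' 0) h" "\<And>v. v \<in> free_mod V (b 0) \<Longrightarrow> aug b' e' (h v) - aug b e v \<in> I"
proof -
  have "\<exists>u. \<forall>j<b 0. u j \<in> free_mod V (b' 0) \<and> aug b' e' (u j) - e j \<in> I"
    using surj e by meson
  then obtain u where u: "\<And>j. j < b 0 \<Longrightarrow> u j \<in> free_mod V (b' 0)"
    "\<And>j. j < b 0 \<Longrightarrow> aug b' e' (u j) - e j \<in> I" by blast
  show ?thesis
  proof (rule that)
    show "lin V (b 0) (b' 0) (\<lambda>v. \<Sum>j<b 0. smul (v j) (u j))" using u(1) by (rule lin_comb)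
  next
    fix v :: "nat \<Rightarrow> 'a mpoly" assume v: "v \<in> free_mod V (b 0)"
    have "aug b' e' (\<Sum>j<b 0. smul (v j) (u j)) - aug b e v = (\<Sum>j<b 0. v j * (aug b' e' (u j) - e j))"
      by (simp add: aug_sum aug_smul aug_def[of b e] sum_subtractf right_diff_distrib mult.commute)
    also have "\<dots> \<in> I"
      by (intro is_ideal_sum[OF I] is_idealD(4)[OF I] u(2) free_mod_Pring[OF v]) simp
    finally show "aug b' e' (\<Sum>j<b 0. smul (v j) (u j)) - aug b e v \<in> I" .
  qed
qed

lemma min_free_resD:
  assumes "min_free_res V I b e d"
  shows "\<And>j. j < b 0 \<Longrightarrow> e j \<in> Pring V"
    and "\<And>i. lin V (b (Suc i)) (b i) (matvec (d (Suc i)) (b i) (b (Suc i)))"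
    and "\<And>i v. max_vec (matvec (d (Suc i)) (b i) (b (Suc i)) v)"
    and "\<And>f. f \<in> Pring V \<Longrightarrow> \<exists>v \<in> free_mod V (b 0). aug b e v - f \<in> I"
    and "\<And>i. cycles V I b e d i = matvec (d (Suc i)) (b i) (b (Suc i)) ` free_mod V (b (Suc i))"
proof -
  note * = assms[unfolded min_free_res_iff]
  show "\<And>j. j < b 0 \<Longrightarrow> e j \<in> Pring V"
    and "\<And>i. lin V (b (Suc i)) (b i) (matvec (d (Suc i)) (b i) (b (Suc i)))"
    and "\<And>i v. max_vec (matvec (d (Suc i)) (b i) (b (Suc i)) v)"
    using * by (simp_all add: lin_matvec max_vec_matvec)
  show "\<And>f. f \<in> Pring V \<Longrightarrow> \<exists>v \<in> free_mod V (b 0). aug b e v - f \<in> I"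
    using * by (elim conjE) (erule bspec)
  show "cycles V I b e d i = matvec (d (Suc i)) (b i) (b (Suc i)) ` free_mod V (b (Suc i))" for i
    using * by (elim conjE) (erule spec)
qed

lemma cycles_free: "v \<in> cycles V I b e d i \<Longrightarrow> v \<in> free_mod V (b i)"
  by (cases i) simp_all

text \<open>Comparison maps \<open>\<phi>\<close>, \<open>\<psi>\<close> between two resolutions are lifted degree by degree; \<open>h\<close> is
  the part of a homotopy from \<open>\<psi> \<circ> \<phi>\<close> to the identity that is visible on cycles.  Because the
  differentials vanish modulo the maximal ideal, so does \<open>\<psi> \<circ> \<phi> - id\<close>.\<close>

lemma comparison_maps:
  assumes I: "is_ideal V I" and F: "min_free_res V I b e d" and F': "min_free_res V I b' e' d'"
  shows "\<exists>\<phi> \<psi> h. lin V (b i) (b' i) \<phi> \<and> lin V (b' i) (b i) \<psi> \<and> lin V (b i) (b (Suc i)) h \<and>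
     (\<forall>v\<in>cycles V I b e d i. \<phi> v \<in> cycles V I b' e' d' i) \<and>
     (\<forall>v\<in>cycles V I b' e' d' i. \<psi> v \<in> cycles V I b e d i) \<and>
     (\<forall>v\<in>cycles V I b e d i. \<psi> (\<phi> v) - v = matvec (d (Suc i)) (b i) (b (Suc i)) (h v)) \<and>
     (\<forall>v\<in>free_mod V (b i). max_vec (\<psi> (\<phi> v) - v))"
proof (induction i)
  case 0
  let ?D = "matvec (d (Suc 0)) (b 0) (b (Suc 0))"
  obtain \<phi> where \<phi>: "lin V (b 0) (b' 0) \<phi>" "\<And>v. v \<in> free_mod V (b 0) \<Longrightarrow> aug b' e' (\<phi> v) - aug b e v \<in> I"
    by (rule aug_lift[where b = b and b' = b' and e = e and e' = e', OF I min_free_resD(1)[OF F] min_free_resD(4)[OF F']]) (assumption | rule that)+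
  obtain \<psi> where \<psi>: "lin V (b' 0) (b 0) \<psi>" "\<And>v. v \<in> free_mod V (b' 0) \<Longrightarrow> aug b e (\<psi> v) - aug b' e' v \<in> I"
    by (rule aug_lift[where b = b' and b' = b and e = e' and e' = e, OF I min_free_resD(1)[OF F'] min_free_resD(4)[OF F]]) (assumption | rule that)+
  have lin\<theta>: "lin V (b 0) (b 0) (\<lambda>v. \<psi> (\<phi> v) - v)"
    by (rule lin_minus[OF lin_compose[OF \<phi>(1) \<psi>(1)] lin_id])
  have \<theta>: "\<psi> (\<phi> v) - v \<in> ?D ` free_mod V (b (Suc 0))" if v: "v \<in> free_mod V (b 0)" for v
  proof -
    have "aug b e (\<psi> (\<phi> v) - v) = (aug b e (\<psi> (\<phi> v)) - aug b' e' (\<phi> v)) + (aug b' e' (\<phi> v) - aug b e v)"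
      by (simp add: aug_diff)
    also have "\<dots> \<in> I" by (intro is_idealD(3)[OF I] \<psi>(2) \<phi>(2) linD(1)[OF \<phi>(1)] v)
    finally have "\<psi> (\<phi> v) - v \<in> cycles V I b e d 0"
      using linD(1)[OF lin\<theta> v] by simp
    then show ?thesis using min_free_resD(5)[OF F] by blast
  qed
  obtain h where h: "lin V (b 0) (b (Suc 0)) h" "\<And>v. v \<in> free_mod V (b 0) \<Longrightarrow> ?D (h v) = \<psi> (\<phi> v) - v"
    by (rule lin_lift[OF min_free_resD(2)[OF F] lin\<theta> \<theta>]) (assumption | rule that)+
  have "\<phi> v \<in> cycles V I b' e' d' 0" if "v \<in> cycles V I b e d 0" for v
    using that is_idealD(3)[OF I \<phi>(2)[of v], of "aug b e v"] linD(1)[OF \<phi>(1)] by simp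
  moreover have "\<psi> v \<in> cycles V I b e d 0" if "v \<in> cycles V I b' e' d' 0" for v
    using that is_idealD(3)[OF I \<psi>(2)[of v], of "aug b' e' v"] linD(1)[OF \<psi>(1)] by simp
  moreover have "max_vec (\<psi> (\<phi> v) - v)" if "v \<in> free_mod V (b 0)" for v
    using \<theta>[OF that] min_free_resD(3)[OF F] by auto
  moreover have "\<psi> (\<phi> v) - v = ?D (h v)" if "v \<in> cycles V I b e d 0" for v
    using h(2)[OF cycles_free[OF that]] by simp
  ultimately show ?case
    using \<phi>(1) \<psi>(1) h(1) by (intro exI conjI ballI)
next
  case (Suc i)
  let ?D = "matvec (d (Suc i)) (b i) (b (Suc i))"
  let ?D' = "matvec (d' (Suc i)) (b' i) (b' (Suc i))"
  let ?D2 = "matvec (d (Suc (Suc i))) (b (Suc i)) (b (Suc (Suc i)))"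
  obtain \<phi> \<psi> h where lin: "lin V (b i) (b' i) \<phi>" "lin V (b' i) (b i) \<psi>" "lin V (b i) (b (Suc i)) h"
    and \<phi>: "\<And>v. v\<in>cycles V I b e d i \<Longrightarrow> \<phi> v \<in> cycles V I b' e' d' i"
    and \<psi>: "\<And>v. v\<in>cycles V I b' e' d' i \<Longrightarrow> \<psi> v \<in> cycles V I b e d i"
    and h: "\<And>v. v\<in>cycles V I b e d i \<Longrightarrow> \<psi> (\<phi> v) - v = ?D (h v)"
    using Suc.IH by blast
  note linD0 = min_free_resD(2)[OF F, of i] and linD0' = min_free_resD(2)[OF F', of i]
  have D: "?D v \<in> cycles V I b e d i" if "v \<in> free_mod V (b (Suc i))" for v
    using that min_free_resD(5)[OF F] by blast
  have D': "?D' v \<in> cycles V I b' e' d' i" if "v \<in> free_mod V (b' (Suc i))" for v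
    using that min_free_resD(5)[OF F'] by blast
  have im\<phi>: "\<phi> (?D v) \<in> ?D' ` free_mod V (b' (Suc i))" if "v \<in> free_mod V (b (Suc i))" for v
    using \<phi>[OF D[OF that]] min_free_resD(5)[OF F'] by blast
  obtain \<phi>' where \<phi>': "lin V (b (Suc i)) (b' (Suc i)) \<phi>'"
    "\<And>v. v \<in> free_mod V (b (Suc i)) \<Longrightarrow> ?D' (\<phi>' v) = \<phi> (?D v)"
    by (rule lin_lift[OF linD0' lin_compose[OF linD0 lin(1)] im\<phi>]) (assumption | rule that)+
  have im\<psi>: "\<psi> (?D' v) \<in> ?D ` free_mod V (b (Suc i))" if "v \<in> free_mod V (b' (Suc i))" for v
    using \<psi>[OF D'[OF that]] min_free_resD(5)[OF F] by blast
  obtain \<psi>' where \<psi>': "lin V (b' (Suc i)) (b (Suc i)) \<psi>'"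
    "\<And>v. v \<in> free_mod V (b' (Suc i)) \<Longrightarrow> ?D (\<psi>' v) = \<psi> (?D' v)"
    by (rule lin_lift[OF linD0 lin_compose[OF linD0' lin(2)] im\<psi>]) (assumption | rule that)+
  \<comment> \<open>Subtracting \<open>h (?D v)\<close> puts the difference among the cycles:
    \<open>?D\<close> of it is \<open>\<psi> (\<phi> (?D v)) - ?D v - ?D (h (?D v))\<close>, which
    vanishes by the induction hypothesis at the cycle \<open>?D v\<close>. Hence
    \<open>\<theta>\<close> lifts along the next differential.\<close>
  define \<theta> where "\<theta> v = \<psi>' (\<phi>' v) - v - h (?D v)" for v
  have lin1: "lin V (b (Suc i)) (b (Suc i)) (\<lambda>v. \<psi>' (\<phi>' v) - v)"
    by (rule lin_minus[OF lin_compose[OF \<phi>'(1) \<psi>'(1)] lin_id])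
  have lin2: "lin V (b (Suc i)) (b (Suc i)) (\<lambda>v. h (?D v))"
    by (rule lin_compose[OF linD0 lin(3)])
  have lin\<theta>: "lin V (b (Suc i)) (b (Suc i)) \<theta>"
    unfolding \<theta>_def by (rule lin_minus[OF lin1 lin2])
  have \<theta>: "\<theta> v \<in> ?D2 ` free_mod V (b (Suc (Suc i)))" if v: "v \<in> free_mod V (b (Suc i))" for v
  proof -
    have "?D (\<theta> v) = ?D (\<psi>' (\<phi>' v)) - ?D v - ?D (h (?D v))"
      unfolding \<theta>_def
      using lin_diff[OF linD0 linD(1)[OF lin1 v] linD(1)[OF lin2 v]]
        lin_diff[OF linD0 linD(1)[OF lin_compose[OF \<phi>'(1) \<psi>'(1)] v] v] by simp
    also have "\<dots> = \<psi> (\<phi> (?D v)) - ?D v - ?D (h (?D v))"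
      using \<psi>'(2)[OF linD(1)[OF \<phi>'(1) v]] \<phi>'(2)[OF v] by simp
    also have "\<dots> = 0" using h[OF D[OF v]] by simp
    finally have "\<theta> v \<in> cycles V I b e d (Suc i)"
      using linD(1)[OF lin\<theta> v] by simp
    then show ?thesis using min_free_resD(5)[OF F] by blast
  qed
  obtain h' where h': "lin V (b (Suc i)) (b (Suc (Suc i))) h'"
    "\<And>v. v \<in> free_mod V (b (Suc i)) \<Longrightarrow> ?D2 (h' v) = \<theta> v"
    by (rule lin_lift[OF min_free_resD(2)[OF F] lin\<theta> \<theta>]) (assumption | rule that)+
  have "\<phi>' v \<in> cycles V I b' e' d' (Suc i)" if "v \<in> cycles V I b e d (Suc i)" for v
    using that \<phi>'(2)[of v] linD(1)[OF \<phi>'(1)] lin_zero[OF lin(1)] by simp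
  moreover have "\<psi>' v \<in> cycles V I b e d (Suc i)" if "v \<in> cycles V I b' e' d' (Suc i)" for v
    using that \<psi>'(2)[of v] linD(1)[OF \<psi>'(1)] lin_zero[OF lin(2)] by simp
  \<comment> \<open>On a cycle \<open>?D v = 0\<close>, so the correction term vanishes and
    \<open>\<theta> v\<close> is the whole difference.\<close>
  moreover have "\<psi>' (\<phi>' v) - v = ?D2 (h' v)" if "v \<in> cycles V I b e d (Suc i)" for v
    using that h'(2)[of v] lin_zero[OF lin(3)] by (simp add: \<theta>_def)
  \<comment> \<open>The difference is \<open>\<theta> v + h (?D v)\<close>: the first summand is a
    value of \<open>?D2\<close>, the second the image under a linear map of a value of
    \<open>?D\<close>, and both differentials are minimal.\<close>
  moreover have "max_vec (\<psi>' (\<phi>' v) - v)" if v: "v \<in> free_mod V (b (Suc i))" for v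
  proof -
    have "max_vec (h (?D v))"
      by (rule max_vec_lin[OF lin(3) linD(1)[OF linD0 v] min_free_resD(3)[OF F]])
    moreover have "max_vec (\<theta> v)" using \<theta>[OF v] min_free_resD(3)[OF F] by auto
    ultimately show ?thesis
      by (simp add: \<theta>_def max_vec_def in_max_ideal_def lookup_minus)
  qed
  ultimately show ?case using \<phi>'(1) \<psi>'(1) h'(1) by (intro exI conjI ballI)
qed

text \<open>If \<open>b i\<close> exceeded \<open>b' i\<close>, the matrix of constant terms of
  \<open>\<phi>\<close> would kill a nonzero constant vector \<open>v\<close>. Then
  \<open>\<phi> v\<close>, hence \<open>\<psi> (\<phi> v)\<close>, hence \<open>v\<close> itself
  would have no constant terms, since \<open>\<psi> \<circ> \<phi>\<close> is the identity modulo
  the maximal ideal.\<close>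

lemma min_free_res_rank_le:
  fixes I :: "'k::field mpoly set"
  assumes I: "is_ideal V I" and F: "min_free_res V I b e d" and F': "min_free_res V I b' e' d'"
  shows "b i \<le> b' i"
proof (rule ccontr)
  assume "\<not> b i \<le> b' i"
  obtain \<phi> \<psi> :: "(nat \<Rightarrow> 'k mpoly) \<Rightarrow> nat \<Rightarrow> 'k mpoly" where \<phi>: "lin V (b i) (b' i) \<phi>" and \<psi>: "lin V (b' i) (b i) \<psi>"
    and \<theta>: "\<forall>v\<in>free_mod V (b i). max_vec (\<psi> (\<phi> v) - v)"
    using comparison_maps[OF assms, of i] by (elim exE conjE) (rule that)
  obtain x where x: "\<And>r. r < b' i \<Longrightarrow> (\<Sum>c<b i. lookup (\<phi> (unit_vec c) r) 0 * x c) = 0"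
    and nz: "\<exists>c<b i. x c \<noteq> 0"
    using homogeneous_system_nontrivial[of "{..<b' i}" "{..<b i}" "\<lambda>r c. lookup (\<phi> (unit_vec c) r) 0"]
      \<open>\<not> b i \<le> b' i\<close> by auto
  define v where "v = (\<lambda>c. if c < b i then single (0::nat \<Rightarrow>\<^sub>0 nat) (x c) else 0)"
  have v: "v \<in> free_mod V (b i)" by (auto simp: free_mod_def v_def intro!: Pring_single)
  have "lookup (\<phi> v r) 0 = 0" for r
  proof (cases "r < b' i")
    case True
    have "lookup (\<phi> v r) 0 = (\<Sum>c<b i. lookup (\<phi> (unit_vec c) r) 0 * x c)"
      unfolding lin_expand[OF \<phi> v] sum_fun_apply lookup_sum
      by (intro sum.cong refl) (simp add: smul_def lookup_mult_zero v_def mult.commute)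
    with x[OF True] show ?thesis by simp
  next
    case False
    then show ?thesis using free_mod_ge[OF linD(1)[OF \<phi> v]] by simp
  qed
  then have "max_vec (\<phi> v)" by (simp add: max_vec_def in_max_ideal_def)
  then have "max_vec (\<psi> (\<phi> v))" by (rule max_vec_lin[OF \<psi> linD(1)[OF \<phi> v]])
  with bspec[OF \<theta> v] have "lookup (v c) 0 = 0" for c
    by (simp add: max_vec_def in_max_ideal_def lookup_minus)
  with nz show False by (auto simp: v_def) (metis lookup_single_eq)
qed

lemma min_free_res_rank_unique:
  assumes "is_ideal V I" "min_free_res V I b e d" "min_free_res V I b' e' d'"
  shows "b = b'"
  using min_free_res_rank_le[OF assms(1,2,3)] min_free_res_rank_le[OF assms(1,3,2)] by (intro ext antisym)

text \<open>The given resolution witnesses existence and \<open>min_free_res_rank_unique\<close>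
  gives uniqueness; together they evaluate the definite description in \<open>betti\<close>.\<close>

lemma betti_eq_rank:
  assumes "is_ideal V I" "min_graded_free_res w V I b sh e d"
  shows "betti w V I i = b i"
  unfolding betti_def
proof (intro the_equality)
  show "\<exists>b' sh e d. min_graded_free_res w V I b' sh e d \<and> b' i = b i" using assms(2) by blast
next
  fix r assume "\<exists>b' sh e d. min_graded_free_res w V I b' sh e d \<and> b' i = r"
  then obtain b' sh' e' d' where *: "min_graded_free_res w V I b' sh' e' d'" "b' i = r" by blast
  have "b' = b"
    by (rule min_free_res_rank_unique[OF assms(1) min_free_res_of_graded[OF *(1)] min_free_res_of_graded[OF assms(2)]])
  with * show "r = b i" by simp
qed

section \<open>Reduction modulo a variable\<close>

text \<open>The substitution of zero for the variable \<open>x\<close>. Its values serve as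
  representatives modulo \<open>x\<close>, so that \<open>Pring (V - {x})\<close> takes the place of
  the quotient ring.\<close>

definition rho :: "nat \<Rightarrow> 'k::field mpoly \<Rightarrow> 'k mpoly" where
  "rho x p = pfilter (\<lambda>m. lookup m x = 0) p"

definition var :: "nat \<Rightarrow> 'k::field mpoly" where
  "var x = single (single x 1) 1"

lemma rho_zero [simp]: "rho x 0 = 0"
  by (simp add: rho_def)

lemma rho_add: "rho x (p + q) = rho x p + rho x q"
  by (simp add: rho_def pfilter_add)

lemma rho_diff: "rho x (p - q) = rho x p - rho x q"
  by (simp add: rho_def pfilter_diff)

lemma rho_sum: "rho x (sum f A) = (\<Sum>i\<in>A. rho x (f i))"
  by (simp add: rho_def pfilter_sum)

lemma rho_mult: "rho x (p * q) = rho x p * rho x q"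
  unfolding rho_def by (rule pfilter_mult) (simp add: lookup_add)

lemma rho_var [simp]: "rho x (var x) = 0"
  by (simp add: rho_def var_def pfilter_single)

lemma rho_Pring: "p \<in> Pring V \<Longrightarrow> rho x p \<in> Pring (V - {x})"
  by (auto simp: rho_def Pring_def keys_pfilter in_keys_iff)

lemma rho_id: "p \<in> Pring (V - {x}) \<Longrightarrow> rho x p = p"
  unfolding rho_def by (rule pfilter_True) (force simp: Pring_def in_keys_iff)

lemma var_Pring: "x \<in> V \<Longrightarrow> var x \<in> Pring V"
  by (auto simp: var_def intro!: Pring_single)

lemma in_max_ideal_rho: "in_max_ideal p \<Longrightarrow> in_max_ideal (rho x p)"
  by (simp add: in_max_ideal_def rho_def lookup_pfilter)

text \<open>Since \<open>rho x p = 0\<close>, every monomial of \<open>p\<close> contains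
  \<open>x\<close>, and the truncated subtraction of exponents is exact.\<close>

lemma var_dvd:
  assumes "p \<in> Pring V" "rho x p = 0"
  obtains q where "q \<in> Pring V" "p = var x * q"
proof
  let ?q = "\<Sum>m\<in>keys p. single (m - single x 1) (lookup p m)"
  have pos: "lookup m x > 0" if "m \<in> keys p" for m
  proof -
    have "lookup (rho x p) m = 0" by (simp add: assms)
    with that show ?thesis by (auto simp: rho_def lookup_pfilter in_keys_iff split: if_splits)
  qed
  show "?q \<in> Pring V"
  proof (intro Pring_sum Pring_single)
    fix m assume "m \<in> keys p"
    then have "keys m \<subseteq> V" using assms(1) by (auto simp: Pring_def)
    moreover have "keys (m - single x 1) \<subseteq> keys m" by (auto simp: in_keys_iff lookup_minus)
    ultimately show "keys (m - single x 1) \<subseteq> V" by blast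
  qed
  have eq: "single x 1 + (m - single x 1) = m" if "m \<in> keys p" for m
    using pos[OF that]
    by (intro poly_mapping_eqI) (auto simp: lookup_add lookup_minus lookup_single when_def)
  have "var x * ?q = (\<Sum>m\<in>keys p. single m (lookup p m))"
    by (simp add: var_def sum_distrib_left mult_single) (rule sum.cong, use eq in auto)
  then show "p = var x * ?q" using poly_mapping_sum_single[of p] by metis
qed

lemma is_ideal_rho:
  assumes "is_ideal V I"
  shows "is_ideal (V - {x}) (rho x ` I)"
  unfolding is_ideal_def
proof (intro conjI ballI)
  show "rho x ` I \<subseteq> Pring (V - {x})" using is_idealD(1)[OF assms] rho_Pring by blast
  show "0 \<in> rho x ` I" using is_idealD(2)[OF assms] by (force intro: image_eqI[of _ _ 0])
  fix f assume f: "f \<in> rho x ` I"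
  show "f + g \<in> rho x ` I" if "g \<in> rho x ` I" for g
    using f that is_idealD(3)[OF assms] by (force simp: rho_add[symmetric])
  show "s * f \<in> rho x ` I" if "s \<in> Pring (V - {x})" for s
  proof -
    from f obtain f' where "f' \<in> I" "f = rho x f'" by blast
    then have "s * f = rho x (s * f')" using rho_id[OF that] by (simp add: rho_mult)
    then show ?thesis using is_idealD(4)[OF assms Pring_mono[OF _ that]] \<open>f' \<in> I\<close> by auto
  qed
qed

definition rhov :: "nat \<Rightarrow> (nat \<Rightarrow> 'k::field mpoly) \<Rightarrow> nat \<Rightarrow> 'k mpoly" where
  "rhov x v = (\<lambda>r. rho x (v r))"

lemma rhov_free: "v \<in> free_mod V b \<Longrightarrow> rhov x v \<in> free_mod (V - {x}) b"
  by (auto simp: free_mod_def rhov_def rho_Pring)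

lemma rhov_id: "v \<in> free_mod (V - {x}) b \<Longrightarrow> rhov x v = v"
  by (rule ext) (simp add: rhov_def rho_id[OF free_mod_Pring])

lemma free_mod_mono: "V \<subseteq> W \<Longrightarrow> v \<in> free_mod V b \<Longrightarrow> v \<in> free_mod W b"
  by (auto simp: free_mod_def intro: Pring_mono)

lemma rhov_matvec: "rhov x (matvec M p q v) = matvec (\<lambda>r c. rho x (M r c)) p q (rhov x v)"
  by (rule ext) (simp add: rhov_def matvec_def rho_sum rho_mult)

lemma rho_aug: "rho x (aug b e v) = aug b (\<lambda>j. rho x (e j)) (rhov x v)"
  by (simp add: rhov_def aug_def rho_sum rho_mult)

lemma rhov_minus_smul_var: "rhov x (v - smul (var x) w) = rhov x v"
  by (rule ext) (simp add: rhov_def smul_def rho_diff rho_mult)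

lemma vec_var_dvd:
  assumes "v \<in> free_mod V b" "rhov x v = 0"
  obtains w where "w \<in> free_mod V b" "v = smul (var x) w"
proof -
  have "\<exists>q. q \<in> Pring V \<and> v r = var x * q" for r
    using var_dvd[OF free_mod_Pring[OF assms(1)], of x r] assms(2) by (metis rhov_def zero_fun_apply)
  then obtain w where w: "\<And>r. w r \<in> Pring V" "\<And>r. v r = var x * w r" by metis
  show ?thesis
  proof
    show "(\<lambda>r. if r < b then w r else 0) \<in> free_mod V b" by (simp add: free_mod_def w)
    show "v = smul (var x) (\<lambda>r. if r < b then w r else 0)"
      using free_mod_ge[OF assms(1)] by (auto simp: smul_def w(2)[symmetric])
  qed
qed

lemma var_mult_cancel: "var x * p = var x * q \<Longrightarrow> p = (q :: 'k::field mpoly)"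
proof -
  have "(var x :: 'k mpoly) \<noteq> 0" by (metis keys_single keys_zero insert_not_empty one_neq_zero var_def)
  then show "var x * p = var x * q \<Longrightarrow> p = q" by simp
qed

text \<open>The point is that a cycle \<open>v\<close> modulo \<open>x\<close> lifts to a true
  cycle. Its differential is \<open>x\<close> times some \<open>w\<close>; cancelling
  \<open>x\<close> shows that \<open>w\<close> is again a cycle, so \<open>w\<close> is the
  differential of some \<open>u\<close>, and \<open>v\<close> minus \<open>x\<close> times
  \<open>u\<close> is a true cycle with the same reduction as \<open>v\<close>.\<close>

lemma min_free_res_mod_var:
  assumes I: "is_ideal V I" and x: "x \<in> V"
    and nzd: "\<And>f. f \<in> Pring V \<Longrightarrow> var x * f \<in> I \<Longrightarrow> f \<in> I"
    and F: "min_free_res V I b e d"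
  shows "min_free_res (V - {x}) (rho x ` I) b (\<lambda>j. rho x (e j)) (\<lambda>i r c. rho x (d i r c))"
  unfolding min_free_res_iff
proof (intro conjI allI ballI impI)
  let ?W = "V - {x}" and ?d = "\<lambda>i r c. rho x (d i r c)" and ?e = "\<lambda>j. rho x (e j)"
  let ?D = "\<lambda>i. matvec (d (Suc i)) (b i) (b (Suc i))"
  show "rho x (e j) \<in> Pring ?W" if "j < b 0" for j
    using min_free_resD(1)[OF F that] by (rule rho_Pring)
  show "rho x (d (Suc i) r c) \<in> Pring ?W" "in_max_ideal (rho x (d (Suc i) r c))"
    if "r < b i" "c < b (Suc i)" for i r c
    using F that by (auto simp: min_free_res_iff intro!: rho_Pring in_max_ideal_rho)
  show "\<exists>v\<in>free_mod ?W (b 0). aug b ?e v - f \<in> rho x ` I" if f: "f \<in> Pring ?W" for f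
  proof -
    obtain v where v: "v \<in> free_mod V (b 0)" "aug b e v - f \<in> I"
      using min_free_resD(4)[OF F Pring_mono[OF _ f]] by blast
    have "aug b ?e (rhov x v) - f = rho x (aug b e v - f)"
      by (simp add: rho_diff rho_aug rho_id[OF f])
    then show ?thesis using v rhov_free by blast
  qed
  fix i
  note lind = min_free_resD(2)[OF F]
  note cyc = min_free_resD(5)[OF F]
  have up: "v \<in> free_mod V c" if "v \<in> free_mod ?W c" for v c
    using that by (rule free_mod_mono[rotated]) blast
  have main: "\<exists>s\<in>free_mod V (b i). v - smul (var x) s \<in> cycles V I b e d i"
    if v: "v \<in> cycles ?W (rho x ` I) b ?e ?d i" for v
  proof (cases i)
    case 0
    then have v: "v \<in> free_mod ?W (b 0)" "aug b ?e v \<in> rho x ` I" using v by auto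
    then obtain g where g: "g \<in> I" "aug b ?e v = rho x g" by blast
    have "rho x (aug b e v - g) = 0" using g v by (simp add: rho_diff rho_aug rhov_id)
    moreover have "aug b e v - g \<in> Pring V"
      by (intro Pring_diff aug_Pring[where b = b and e = e] min_free_resD(1)[OF F] up[OF v(1)] is_idealD(1)[OF I g(1)])
    ultimately obtain t where t: "t \<in> Pring V" "aug b e v - g = var x * t" using var_dvd by metis
    \<comment> \<open>At index 0 the correction comes from surjectivity of the augmentation:
      \<open>t\<close> is hit by some \<open>s\<close> up to an element of \<open>I\<close>.\<close>
    obtain s where s: "s \<in> free_mod V (b 0)" "aug b e s - t \<in> I" using min_free_resD(4)[OF F t(1)] by blast
    have "aug b e (v - smul (var x) s) = g - var x * (aug b e s - t)"
      using t(2) by (simp add: aug_diff aug_smul algebra_simps)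
    also have "\<dots> \<in> I" by (intro is_idealD(5)[OF I] g is_idealD(4)[OF I] s var_Pring x)
    finally have "v - smul (var x) s \<in> cycles V I b e d 0"
      using up[OF v(1)] s(1) var_Pring[OF x] by auto
    with s(1) 0 show ?thesis by auto
  next
    case (Suc k)
    then have v: "v \<in> free_mod ?W (b (Suc k))" "matvec (?d (Suc k)) (b k) (b (Suc k)) v = 0" using v by auto
    have "rhov x (?D k v) = 0" using v by (simp add: rhov_matvec rhov_id)
    then obtain w where w: "w \<in> free_mod V (b k)" "?D k v = smul (var x) w"
      using vec_var_dvd linD(1)[OF lind up[OF v(1)]] by metis
    have "smul (var x) w \<in> cycles V I b e d k" using cyc[of k] up[OF v(1)] w(2) by force
    \<comment> \<open>For \<open>k = 0\<close> the variable is cancelled modulo \<open>I\<close> by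
      \<open>nzd\<close>; for larger \<open>k\<close> it is cancelled componentwise in the
      polynomial ring.\<close>
    then have "w \<in> cycles V I b e d k"
    proof (cases k)
      case 0
      then show ?thesis
        using \<open>smul (var x) w \<in> cycles V I b e d k\<close> w(1) nzd[of "aug b e w"]
          aug_Pring[where b = b and e = e, OF min_free_resD(1)[OF F]]
        by (auto simp: aug_smul)
    next
      case (Suc l)
      have "smul (var x) (?D l w) = 0"
        using \<open>smul (var x) w \<in> cycles V I b e d k\<close> Suc linD(3)[OF lind var_Pring[OF x], of w l] w(1) by simp
      then have "?D l w r = 0" for r
        using var_mult_cancel[of x "?D l w r" 0] by (metis mult_zero_right smul_def zero_fun_apply)
      then have "?D l w = 0" by (simp add: fun_eq_iff)
      then show ?thesis using Suc w(1) by simp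
    qed
    then obtain u where u: "u \<in> free_mod V (b (Suc k))" "w = ?D k u" using cyc[of k] by auto
    have "?D k (v - smul (var x) u) = 0"
      using lin_diff[OF lind up[OF v(1)] free_mod_smul[OF var_Pring[OF x] u(1)]]
        linD(3)[OF lind var_Pring[OF x] u(1)] w(2) u(2) by simp
    then have "v - smul (var x) u \<in> cycles V I b e d (Suc k)"
      using up[OF v(1)] u(1) var_Pring[OF x] by auto
    with u(1) Suc show ?thesis by auto
  qed
  show "cycles ?W (rho x ` I) b ?e ?d i = matvec (?d (Suc i)) (b i) (b (Suc i)) ` free_mod ?W (b (Suc i))"
  proof (intro equalityI subsetI)
    fix v assume v: "v \<in> cycles ?W (rho x ` I) b ?e ?d i"
    then obtain s where s: "s \<in> free_mod V (b i)" "v - smul (var x) s \<in> cycles V I b e d i"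
      using main by blast
    then obtain z where z: "z \<in> free_mod V (b (Suc i))" "v - smul (var x) s = ?D i z"
      using cyc[of i] by auto
    have "v = rhov x (v - smul (var x) s)"
      using rhov_id[OF cycles_free[OF v]] by (simp add: rhov_minus_smul_var)
    also have "\<dots> = matvec (?d (Suc i)) (b i) (b (Suc i)) (rhov x z)"
      by (simp add: z rhov_matvec)
    finally show "v \<in> matvec (?d (Suc i)) (b i) (b (Suc i)) ` free_mod ?W (b (Suc i))"
      using rhov_free[OF z(1)] by blast
  next
    fix v assume "v \<in> matvec (?d (Suc i)) (b i) (b (Suc i)) ` free_mod ?W (b (Suc i))"
    then obtain z where z: "z \<in> free_mod ?W (b (Suc i))" "v = matvec (?d (Suc i)) (b i) (b (Suc i)) z" by blast
    then have v: "v = rhov x (?D i z)" by (simp add: rhov_matvec rhov_id)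
    have c: "?D i z \<in> cycles V I b e d i" using cyc[of i] up[OF z(1)] by auto
    have vW: "v \<in> free_mod ?W (b i)" unfolding v by (rule rhov_free[OF cycles_free[OF c]])
    show "v \<in> cycles ?W (rho x ` I) b ?e ?d i"
    proof (cases i)
      case 0
      then show ?thesis using vW c by (auto simp: v rho_aug[symmetric])
    next
      case (Suc k)
      then have "?D k (?D i z) = 0" using c by simp
      then have "matvec (?d (Suc k)) (b k) (b (Suc k)) v = rhov x 0"
        using Suc by (simp add: v rhov_matvec[symmetric])
      then show ?thesis using vW Suc by (simp add: rhov_def zero_fun_def)
    qed
  qed
qed

section \<open>Existence of minimal graded free resolutions\<close>

lemma ev_add:
  "(\<Sum>j\<in>keys (m + m'). lookup (m + m') j * f j) =
   (\<Sum>j\<in>keys m. lookup m j * f j) + (\<Sum>j\<in>keys m'. lookup m' j * (f j :: nat))"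
  by (rule setsum_keys_plus_distrib[where f = "\<lambda>j a. a * f j"]) (auto simp: distrib_right)

lemma wdeg_add: "wdeg w (m + m') = wdeg w m + wdeg w m'"
  by (simp add: wdeg_def ev_add)

lemma wdeg_zero [simp]: "wdeg w 0 = 0"
  by (simp add: wdeg_def)

definition hc :: "(nat \<Rightarrow> nat) \<Rightarrow> int \<Rightarrow> 'k::field mpoly \<Rightarrow> 'k mpoly" where
  "hc w \<delta> p = pfilter (\<lambda>m. wdeg w m = \<delta>) p"

lemma hc_mult_homogeneous:
  assumes "homogeneous w \<epsilon> p"
  shows "hc w \<delta> (p * q) = p * hc w (\<delta> - \<epsilon>) q"
proof -
  have "hc w \<delta> (p * q) = pfilter (\<lambda>_. True) p * pfilter (\<lambda>m. wdeg w m = \<delta> - \<epsilon>) q"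
    unfolding hc_def
    by (rule pfilter_mult) (use assms in \<open>auto simp: homogeneous_def wdeg_add\<close>)
  then show ?thesis by (simp add: pfilter_True hc_def)
qed

lemma homogeneous_hc: "homogeneous w \<delta> (hc w \<delta> p)"
  by (simp add: homogeneous_def hc_def keys_pfilter)

lemma homogeneous_diff: "homogeneous w \<delta> p \<Longrightarrow> homogeneous w \<delta> q \<Longrightarrow> homogeneous w \<delta> (p - q)"
  unfolding homogeneous_def by (metis Un_iff in_keys_iff lookup_minus right_minus_eq)

lemma homogeneous_mult: "homogeneous w \<delta> p \<Longrightarrow> homogeneous w \<epsilon> q \<Longrightarrow> homogeneous w (\<delta> + \<epsilon>) (p * q)"
  unfolding homogeneous_def using keys_mult[of p q] by (fastforce simp: wdeg_add)

text \<open>Basis vector \<open>r\<close> sits in degree \<open>sh r\<close>, so a vector of degree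
  \<open>\<delta>\<close> has its component \<open>r\<close> in degree
  \<open>\<delta> - sh r\<close>.\<close>

definition vhc :: "(nat \<Rightarrow> nat) \<Rightarrow> (nat \<Rightarrow> int) \<Rightarrow> int \<Rightarrow> (nat \<Rightarrow> 'k::field mpoly) \<Rightarrow> nat \<Rightarrow> 'k mpoly" where
  "vhc w sh \<delta> v = (\<lambda>r. hc w (\<delta> - sh r) (v r))"

definition vhom :: "(nat \<Rightarrow> nat) \<Rightarrow> nat \<Rightarrow> (nat \<Rightarrow> int) \<Rightarrow> int \<Rightarrow> (nat \<Rightarrow> 'k::field mpoly) \<Rightarrow> bool" where
  "vhom w b sh \<delta> v \<longleftrightarrow> (\<forall>r<b. homogeneous w (\<delta> - sh r) (v r))"

definition submod :: "nat set \<Rightarrow> nat \<Rightarrow> (nat \<Rightarrow> 'k::field mpoly) set \<Rightarrow> bool" where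
  "submod V b N \<longleftrightarrow> N \<subseteq> free_mod V b \<and> 0 \<in> N \<and> (\<forall>v\<in>N. \<forall>w\<in>N. v + w \<in> N) \<and>
     (\<forall>s\<in>Pring V. \<forall>v\<in>N. smul s v \<in> N)"

definition gsub :: "(nat \<Rightarrow> nat) \<Rightarrow> nat set \<Rightarrow> nat \<Rightarrow> (nat \<Rightarrow> int) \<Rightarrow> (nat \<Rightarrow> 'k::field mpoly) set \<Rightarrow> bool" where
  "gsub w V b sh N \<longleftrightarrow> submod V b N \<and> (\<forall>v\<in>N. \<forall>\<delta>. vhc w sh \<delta> v \<in> N)"

text \<open>As an intersection the span has its minimality built in. It is meaningful for
  \<open>G\<close> inside \<open>free_mod V b\<close>; otherwise the intersection is over the empty
  family.\<close>

definition mspan :: "nat set \<Rightarrow> nat \<Rightarrow> (nat \<Rightarrow> 'k::field mpoly) set \<Rightarrow> (nat \<Rightarrow> 'k mpoly) set" where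
  "mspan V b G = \<Inter>{N. submod V b N \<and> G \<subseteq> N}"

lemma submodD:
  assumes "submod V b N"
  shows "\<And>v. v \<in> N \<Longrightarrow> v \<in> free_mod V b" "0 \<in> N" "\<And>v w. v \<in> N \<Longrightarrow> w \<in> N \<Longrightarrow> v + w \<in> N"
    "\<And>s v. s \<in> Pring V \<Longrightarrow> v \<in> N \<Longrightarrow> smul s v \<in> N"
  using assms by (auto simp: submod_def)

lemma submod_diff:
  assumes "submod V b N" "v \<in> N" "w \<in> N"
  shows "v - w \<in> N"
proof -
  have "v + smul (- 1) w \<in> N"
    by (intro submodD(3,4)[OF assms(1)] assms(2,3) Pring_uminus Pring_one)
  then show ?thesis by (simp add: smul_minus_one)
qed

lemma submod_sum: "submod V b N \<Longrightarrow> (\<And>i. i \<in> A \<Longrightarrow> f i \<in> N) \<Longrightarrow> sum f A \<in> N"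
  by (induction A rule: infinite_finite_induct) (auto simp: submodD)

lemma submod_free: "submod V b (free_mod V b)"
  unfolding submod_def by (intro conjI ballI free_mod_add free_mod_smul) auto

lemma mspan_superset: "G \<subseteq> mspan V b G"
  by (auto simp: mspan_def)

lemma mspan_least: "submod V b N \<Longrightarrow> G \<subseteq> N \<Longrightarrow> mspan V b G \<subseteq> N"
  by (auto simp: mspan_def)

lemma submod_mspan: "G \<subseteq> free_mod V b \<Longrightarrow> submod V b (mspan V b G)"
  unfolding submod_def[of V b "mspan V b G"]
  by (intro conjI mspan_least submod_free) (auto simp: mspan_def submodD)

lemma submod_image:
  assumes "lin V c b f"
  shows "submod V b (f ` free_mod V c)"
  unfolding submod_def
proof (intro conjI ballI)
  show "f ` free_mod V c \<subseteq> free_mod V b" using linD(1)[OF assms] by blast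
  show "0 \<in> f ` free_mod V c" by (rule image_eqI[of _ _ 0]) (simp_all add: lin_zero[OF assms])
  fix v assume "v \<in> f ` free_mod V c"
  then obtain v' where v': "v = f v'" "v' \<in> free_mod V c" by blast
  show "v + u \<in> f ` free_mod V c" if "u \<in> f ` free_mod V c" for u
  proof -
    from that obtain u' where u': "u = f u'" "u' \<in> free_mod V c" by blast
    then have "v + u = f (v' + u')" using v' linD(2)[OF assms] by simp
    then show ?thesis using v' u' by blast
  qed
  show "smul s v \<in> f ` free_mod V c" if "s \<in> Pring V" for s
  proof -
    have "smul s v = f (smul s v')" using v' linD(3)[OF assms that] by simp
    then show ?thesis using v' that by blast
  qed
qed

lemma submod_kernel:
  assumes "lin V c b f"
  shows "submod V c {v \<in> free_mod V c. f v = 0}"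
  unfolding submod_def
proof (intro conjI ballI)
  show "smul s v \<in> {v \<in> free_mod V c. f v = 0}" if "s \<in> Pring V" "v \<in> {v \<in> free_mod V c. f v = 0}" for s v
  proof -
    have "f (smul s v) = smul s 0" using that linD(3)[OF assms that(1), of v] by simp
    then show ?thesis using that free_mod_smul[of s V v c] by (simp add: smul_def zero_fun_def)
  qed
qed (auto simp: lin_zero[OF assms] linD(2)[OF assms])

section \<open>Finite generation of graded submodules through leading terms\<close>

lemma dickson_sequences:
  fixes C :: "(nat \<Rightarrow> nat) set"
  assumes "finite C"
  shows "\<exists>r :: nat \<Rightarrow> nat. strict_mono r \<and> (\<forall>f\<in>C. mono (f \<circ> r))"
  using assms
proof induction
  case empty
  then show ?case by (auto intro!: exI[of _ id] strict_monoI)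
next
  case (insert f C)
  then obtain r :: "nat \<Rightarrow> nat" where r: "strict_mono r" "\<And>g. g \<in> C \<Longrightarrow> mono (g \<circ> r)" by blast
  obtain s where s: "strict_mono s" "monoseq (\<lambda>n. (f \<circ> r) (s n))"
    using seq_monosub[of "f \<circ> r"] by blast
  \<comment> \<open>A decreasing sequence of naturals is constant from the first index
    \<open>k\<close> that attains its least value, so dropping \<open>k\<close> terms makes a
    monotone sequence nondecreasing in either case. Refining the subsequence keeps the earlier
    coordinates monotone.\<close>
  have "\<exists>k. mono (\<lambda>n. f (r (s (n + k))))"
  proof (cases "mono (\<lambda>n. f (r (s n)))")
    case True
    then show ?thesis by (intro exI[of _ 0]) simp
  next
    case False
    then have dec: "\<And>m n. m \<le> n \<Longrightarrow> f (r (s n)) \<le> f (r (s m))"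
      using s(2) by (auto simp: monoseq_def mono_def)
    obtain k where k: "\<And>n. f (r (s k)) \<le> f (r (s n))"
      using ex_has_least_nat[of "\<lambda>_. True" 0 "\<lambda>n. f (r (s n))"] by auto
    have "f (r (s (n + k))) = f (r (s k))" for n
      using k[of "n + k"] dec[of k "n + k"] by simp
    then show ?thesis by (intro exI[of _ k]) (simp add: mono_def)
  qed
  then obtain k where k: "mono (\<lambda>n. f (r (s (n + k))))" by blast
  define t where "t = (\<lambda>n. s (n + k))"
  have t: "strict_mono t" using s(1) by (auto simp: t_def strict_mono_def)
  have "mono (g \<circ> (r \<circ> t))" if "g \<in> C" for g
    using r(2)[OF that] strict_mono_mono[OF t] by (auto simp: mono_def)
  then show ?case
    using k strict_mono_o[OF r(1) t] by (intro exI[of _ "r \<circ> t"]) (auto simp: t_def o_def)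
qed

text \<open>Positive weights bound each exponent by the degree. This finiteness is what later
  provides a least leading term within a fixed degree.\<close>

lemma finite_monomials_of_degree:
  assumes "finite V" "\<And>j. j \<in> V \<Longrightarrow> w j > 0"
  shows "finite {m. keys m \<subseteq> V \<and> wdeg w m = \<delta>}"
proof (rule finite_imageD)
  show "inj_on lookup {m :: nat \<Rightarrow>\<^sub>0 nat. keys m \<subseteq> V \<and> wdeg w m = \<delta>}"
    by (intro inj_onI poly_mapping_eqI) simp
  have "lookup m j \<le> nat \<delta>" if "keys m \<subseteq> V" "wdeg w m = \<delta>" "j \<in> V" for m j
  proof (cases "j \<in> keys m")
    case True
    have "lookup m j \<le> lookup m j * w j" using assms(2)[OF that(3)] by simp
    also have "\<dots> \<le> (\<Sum>j\<in>keys m. lookup m j * w j)" by (rule member_le_sum[OF True]) auto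
    finally show ?thesis by (simp only: that(2)[symmetric] wdeg_def nat_int)
  qed (simp add: in_keys_iff)
  then have "lookup ` {m. keys m \<subseteq> V \<and> wdeg w m = \<delta>}
      \<subseteq> {f. \<forall>x. (x \<in> V \<longrightarrow> f x \<in> {..nat \<delta>}) \<and> (x \<notin> V \<longrightarrow> f x = 0)}"
    by (auto simp: in_keys_iff)
  then show "finite (lookup ` {m. keys m \<subseteq> V \<and> wdeg w m = \<delta>})"
    by (rule finite_subset) (intro finite_set_of_finite_funs assms(1) finite_atMost)
qed

lemma lookup_single_mult:
  fixes p :: "(nat \<Rightarrow>\<^sub>0 nat) \<Rightarrow>\<^sub>0 'k::field"
  shows "lookup (single c a * p) (c + m) = a * lookup p m"
proof -
  have "single c a * p = (\<Sum>m'\<in>keys p. single (c + m') (a * lookup p m'))"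
    by (subst (1) poly_mapping_sum_single[of p]) (simp add: sum_distrib_left mult_single)
  then have "lookup (single c a * p) (c + m) = (\<Sum>m'\<in>keys p. if m' = m then a * lookup p m else 0)"
    by (auto simp: lookup_sum lookup_single when_def intro!: sum.cong)
  then show ?thesis by (auto simp: in_keys_iff)
qed

text \<open>Pairs are ordered lexicographically with the position first, so
  \<open>Max (supp b v)\<close> is the leading term of \<open>v\<close> in a position-over-term
  order.\<close>

definition supp :: "nat \<Rightarrow> (nat \<Rightarrow> 'k::field mpoly) \<Rightarrow> (nat \<times> (nat \<Rightarrow>\<^sub>0 nat)) set" where
  "supp b v = Sigma {..<b} (\<lambda>j. keys (v j))"

lemma finite_supp [simp]: "finite (supp b v)"
  by (simp add: supp_def)

lemma supp_empty: "v \<in> free_mod V b \<Longrightarrow> supp b v = {} \<Longrightarrow> v = 0"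
proof
  fix r assume v: "v \<in> free_mod V b" "supp b v = {}"
  show "v r = 0 r"
  proof (cases "r < b")
    case True
    then have "keys (v r) = {}" using v(2) unfolding supp_def by blast
    then show ?thesis by simp
  qed (use free_mod_ge[OF v(1)] in simp)
qed

text \<open>Dickson's lemma for leading terms: every new generator is chosen with least leading term
  among the homogeneous elements of its degree outside the span of the previous ones, so its leading
  term is divisible by no earlier leading term.\<close>

lemma graded_submodule_finitely_generated:
  fixes N :: "(nat \<Rightarrow> 'k::field mpoly) set"
  assumes V: "finite V" and w: "\<And>j. j \<in> V \<Longrightarrow> w j > 0" and N: "gsub w V b sh N"
  shows "\<exists>G. finite G \<and> (\<forall>g\<in>G. g \<in> N \<and> (\<exists>\<delta>. vhom w b sh \<delta> g)) \<and>
    (\<forall>v\<in>N. \<forall>\<delta>. vhom w b sh \<delta> v \<longrightarrow> v \<in> mspan V b G)"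
proof (rule ccontr)
  assume contra: "\<not> ?thesis"
  have sN: "submod V b N" using N by (simp add: gsub_def)
  define NH where "NH = {v\<in>N. \<exists>\<delta>. vhom w b sh \<delta> v}"
  have NHfree: "G \<subseteq> free_mod V b" if "G \<subseteq> NH" for G
    using that submodD(1)[OF sN] by (auto simp: NH_def)
  define Pk where "Pk G v \<longleftrightarrow> v \<in> N \<and> v \<notin> mspan V b G \<and>
      (\<exists>\<delta>. vhom w b sh \<delta> v \<and> (\<forall>u\<in>N. vhom w b sh \<delta> u \<and> u \<notin> mspan V b G \<longrightarrow> Max (supp b v) \<le> Max (supp b u)))" for G v
  have ex: "\<exists>v. Pk G v" if G: "finite G" "G \<subseteq> NH" for G
  proof -
    obtain v0 \<delta> where v0: "v0 \<in> N" "vhom w b sh \<delta> v0" "v0 \<notin> mspan V b G"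
      using contra G unfolding NH_def by blast
    define U where "U = {u\<in>N. vhom w b sh \<delta> u \<and> u \<notin> mspan V b G}"
    have zero: "0 \<in> mspan V b G" using submodD(2)[OF submod_mspan[OF NHfree[OF G(2)]]] .
    \<comment> \<open>The leading terms of elements of degree \<open>\<delta>\<close> lie in a
      finite set, so some element of \<open>U\<close> attains the least one.\<close>
    have "Max (supp b u) \<in> Sigma {..<b} (\<lambda>j. {m. keys m \<subseteq> V \<and> wdeg w m = \<delta> - sh j})" if "u \<in> U" for u
    proof -
      have u: "u \<in> free_mod V b" "u \<noteq> 0" "vhom w b sh \<delta> u"
        using that submodD(1)[OF sN] zero by (auto simp: U_def)
      then have "Max (supp b u) \<in> supp b u" using supp_empty by (intro Max_in) auto
      then show ?thesis
        using u free_mod_Pring[OF u(1)] by (auto simp: supp_def vhom_def homogeneous_def Pring_def)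
    qed
    then have "(\<lambda>u. Max (supp b u)) ` U \<subseteq> Sigma {..<b} (\<lambda>j. {m. keys m \<subseteq> V \<and> wdeg w m = \<delta> - sh j})" by blast
    moreover have "finite (Sigma {..<b} (\<lambda>j. {m. keys m \<subseteq> V \<and> wdeg w m = \<delta> - sh j}))"
      by (intro finite_SigmaI finite_monomials_of_degree V w) auto
    ultimately have fin: "finite ((\<lambda>u. Max (supp b u)) ` U)" by (rule finite_subset)
    have "(\<lambda>u. Max (supp b u)) ` U \<noteq> {}" using v0 by (auto simp: U_def)
    then obtain v where v: "v \<in> U" "Max (supp b v) = Min ((\<lambda>u. Max (supp b u)) ` U)"
      using Min_in[OF fin] by (metis (no_types, lifting) imageE)
    have "Max (supp b v) \<le> Max (supp b u)" if "u \<in> U" for u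
      unfolding v(2) using fin that by (intro Min_le) auto
    then show ?thesis using v(1) unfolding Pk_def U_def by blast
  qed
  define pick where "pick G = (SOME v. Pk G v)" for G
  define Gs where "Gs = rec_nat {} (\<lambda>_ G. insert (pick G) G)"
  have Gs0: "Gs 0 = {}" and GsS: "Gs (Suc k) = insert (pick (Gs k)) (Gs k)" for k
    by (simp_all add: Gs_def)
  define g where "g k = pick (Gs k)" for k
  have Gs: "finite (Gs k) \<and> Gs k \<subseteq> NH" for k
  proof (induction k)
    case 0 then show ?case by (simp add: Gs0)
  next
    case (Suc k)
    then have "Pk (Gs k) (pick (Gs k))" unfolding pick_def by (blast intro: someI_ex[OF ex])
    then show ?case using Suc by (auto simp: GsS Pk_def NH_def)
  qed
  have g: "Pk (Gs k) (g k)" for k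
    unfolding g_def pick_def using Gs[of k] by (blast intro: someI_ex[OF ex])
  have gin: "g i \<in> Gs k" if "i < k" for i k
    using that by (induction k) (auto simp: GsS g_def less_Suc_eq)
  have gN: "g k \<in> N" and gns: "g k \<notin> mspan V b (Gs k)" for k using g[of k] by (auto simp: Pk_def)
  have gfree: "g k \<in> free_mod V b" for k using submodD(1)[OF sN gN] .
  have gnz: "g k \<noteq> 0" for k
    using gns[of k] submodD(2)[OF submod_mspan[OF NHfree]] Gs[of k] by metis
  define J where "J k = fst (Max (supp b (g k)))" for k
  define M where "M k = snd (Max (supp b (g k)))" for k
  have LT: "Max (supp b (g k)) = (J k, M k)" for k by (simp add: J_def M_def)
  have "(J k, M k) \<in> supp b (g k)" for k
    unfolding LT[symmetric] using gnz[of k] supp_empty[OF gfree[of k]] by (intro Max_in) auto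
  then have JM: "J k < b" "lookup (g k (J k)) (M k) \<noteq> 0" for k
    unfolding supp_def by (auto simp: in_keys_iff)
  have keysM: "keys (M k) \<subseteq> V" for k
    using free_mod_Pring[OF gfree[of k]] JM(2)[of k] by (auto simp: Pring_iff)
  \<comment> \<open>Both \<open>J\<close> and \<open>b - J\<close> are included: nondecreasing in
    both along the subsequence means that the position of the leading term is constant.\<close>
  define C where "C = (\<lambda>x k. lookup (M k) x) ` V \<union> {J, \<lambda>k. b - J k}"
  have "finite C" using V by (simp add: C_def)
  obtain r :: "nat \<Rightarrow> nat" where r: "strict_mono r" "\<And>f. f \<in> C \<Longrightarrow> mono (f \<circ> r)"
    using dickson_sequences[OF \<open>finite C\<close>] by blast
  define i where "i = r 0"
  define k where "k = r 1"
  have ik: "i < k" using r(1) by (simp add: i_def k_def strict_mono_def)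
  have le: "f i \<le> f k" if "f \<in> C" for f
    using r(2)[OF that] by (auto simp: mono_def i_def k_def)
  have J: "J i = J k"
    using le[of J] le[of "\<lambda>k. b - J k"] JM(1)[of i] JM(1)[of k] by (auto simp: C_def)
  define c where "c = M k - M i"
  have Mk: "M k = c + M i"
  proof (rule poly_mapping_eqI)
    fix x show "lookup (M k) x = lookup (c + M i) x"
    proof (cases "x \<in> V")
      case True
      then have "lookup (M i) x \<le> lookup (M k) x" using le[of "\<lambda>k. lookup (M k) x"] by (auto simp: C_def)
      then show ?thesis by (simp add: c_def lookup_add lookup_minus)
    next
      case False
      then have "lookup (M i) x = 0" "lookup (M k) x = 0"
        using keysM[of i] keysM[of k] by (metis in_keys_iff subsetD)+
      then show ?thesis by (simp add: c_def lookup_add lookup_minus)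
    qed
  qed
  have keysc: "keys c \<subseteq> V" using keysM[of k] by (auto simp: Mk keys_add_nat)
  define \<mu> where "\<mu> = lookup (g k (J k)) (M k) / lookup (g i (J i)) (M i)"
  \<comment> \<open>The multiple of \<open>g i\<close> cancels the leading term of
    \<open>g k\<close>. The result has the same degree and stays outside the span of the earlier
    generators, so its smaller leading term will contradict the choice of
    \<open>g k\<close>.\<close>
  define u where "u = g k - smul (single c \<mu>) (g i)"
  have cP: "single c \<mu> \<in> Pring V" by (rule Pring_single[OF keysc])
  have uN: "u \<in> N" unfolding u_def by (intro submod_diff[OF sN] submodD(4)[OF sN cP] gN)
  have smspan: "submod V b (mspan V b (Gs k))" by (intro submod_mspan NHfree) (use Gs in auto)
  have giS: "smul (single c \<mu>) (g i) \<in> mspan V b (Gs k)"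
    using submodD(4)[OF smspan cP] mspan_superset gin[OF ik] by blast
  have uns: "u \<notin> mspan V b (Gs k)"
  proof
    assume "u \<in> mspan V b (Gs k)"
    then have "u + smul (single c \<mu>) (g i) \<in> mspan V b (Gs k)" by (rule submodD(3)[OF smspan _ giS])
    then show False using gns by (simp add: u_def)
  qed
  obtain \<delta> where \<delta>: "vhom w b sh \<delta> (g k)"
    and min: "\<And>u. u \<in> N \<Longrightarrow> vhom w b sh \<delta> u \<Longrightarrow> u \<notin> mspan V b (Gs k) \<Longrightarrow> (J k, M k) \<le> Max (supp b u)"
    using g[of k] unfolding Pk_def LT by blast
  obtain \<epsilon> where \<epsilon>: "vhom w b sh \<epsilon> (g i)" using g[of i] unfolding Pk_def by blast
  have \<delta>J: "wdeg w (M k) = \<delta> - sh (J k)" using \<delta> JM[of k] by (auto simp: vhom_def homogeneous_def in_keys_iff)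
  have \<epsilon>J: "wdeg w (M i) = \<epsilon> - sh (J i)" using \<epsilon> JM[of i] by (auto simp: vhom_def homogeneous_def in_keys_iff)
  have "wdeg w c + \<epsilon> = \<delta>" using \<delta>J \<epsilon>J by (simp add: Mk wdeg_add J)
  have "vhom w b sh \<delta> u"
    unfolding vhom_def
  proof (intro allI impI)
    fix r assume "r < b"
    have "homogeneous w (wdeg w c) (single c \<mu>)" by (simp add: homogeneous_def)
    moreover have "homogeneous w (\<epsilon> - sh r) (g i r)" using \<epsilon> \<open>r < b\<close> by (simp add: vhom_def)
    ultimately have "homogeneous w (wdeg w c + (\<epsilon> - sh r)) (single c \<mu> * g i r)" by (rule homogeneous_mult)
    then have "homogeneous w (\<delta> - sh r) (single c \<mu> * g i r)" by (simp add: \<open>wdeg w c + \<epsilon> = \<delta>\<close>[symmetric] algebra_simps)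
    moreover have "homogeneous w (\<delta> - sh r) (g k r)" using \<delta> \<open>r < b\<close> by (simp add: vhom_def)
    ultimately show "homogeneous w (\<delta> - sh r) (u r)" by (simp add: u_def smul_def homogeneous_diff)
  qed
  then have LTle: "(J k, M k) \<le> Max (supp b u)" by (rule min[OF uN _ uns])
  have "u \<noteq> 0" using uns submodD(2)[OF smspan] by auto
  then have mem: "Max (supp b u) \<in> supp b u"
    using supp_empty[OF submodD(1)[OF sN uN]] by (intro Max_in) auto
  obtain j m where jm: "Max (supp b u) = (j, m)" by (cases "Max (supp b u)")
  have "(j, m) \<in> supp b u" using mem by (simp only: jm)
  then have jb: "j < b" and mu: "lookup (u j) m \<noteq> 0" unfolding supp_def by (auto simp: in_keys_iff)
  have "lookup (g k j) m \<noteq> 0 \<or> lookup (single c \<mu> * g i j) m \<noteq> 0"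
    using mu by (auto simp: u_def smul_def lookup_minus)
  \<comment> \<open>The leading term of \<open>u\<close> comes from \<open>g k\<close> or from the
    multiple of \<open>g i\<close>; adding \<open>c\<close> to exponents preserves the order, so
    both are bounded by the leading term of \<open>g k\<close>.\<close>
  then have "(j, m) \<le> (J k, M k)"
  proof
    assume "lookup (g k j) m \<noteq> 0"
    then have "(j, m) \<in> supp b (g k)" using jb by (simp add: supp_def in_keys_iff)
    then show ?thesis unfolding LT[symmetric] by (intro Max_ge) auto
  next
    assume "lookup (single c \<mu> * g i j) m \<noteq> 0"
    then have "m \<in> keys (single c \<mu> * g i j)" by (simp add: in_keys_iff)
    then obtain m' where m': "m' \<in> keys (g i j)" "m = c + m'"
      using keys_mult[of "single c \<mu>" "g i j"] by (auto split: if_splits)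
    then have "(j, m') \<in> supp b (g i)" using jb by (simp add: supp_def)
    then have "(j, m') \<le> (J i, M i)" unfolding LT[symmetric] by (intro Max_ge) auto
    then show ?thesis using J by (auto simp: less_eq_prod_def Mk m'(2))
  qed
  with LTle jm have "j = J k" "m = M k" by auto
  moreover have "lookup (u (J k)) (M k) = 0"
    using JM(2)[of i] lookup_single_mult[of c \<mu> "g i (J k)" "M i"]
    by (simp add: u_def smul_def lookup_minus Mk J \<mu>_def)
  ultimately show False using mu by simp
qed

section \<open>Minimal generators, syzygies and their iteration\<close>

lemma vhc_free: "v \<in> free_mod V b \<Longrightarrow> vhc w sh \<delta> v \<in> free_mod V b"
  by (auto simp: free_mod_def vhc_def hc_def)

lemma vhom_vhc: "vhom w b sh \<delta> (vhc w sh \<delta> v)"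
  by (simp add: vhom_def vhc_def homogeneous_hc)

lemma vec_sum_components:
  fixes v :: "nat \<Rightarrow> 'k::field mpoly"
  assumes "v \<in> free_mod V b"
  shows "\<exists>D. finite D \<and> v = (\<Sum>\<delta>\<in>D. vhc w sh \<delta> v)"
proof (intro exI conjI)
  let ?D = "\<Union>r<b. (\<lambda>m. wdeg w m + sh r) ` keys (v r)"
  show fin: "finite ?D" by simp
  show "v = (\<Sum>\<delta>\<in>?D. vhc w sh \<delta> v)"
  proof (intro ext poly_mapping_eqI)
    fix r m
    have "lookup ((\<Sum>\<delta>\<in>?D. vhc w sh \<delta> v) r) m = (\<Sum>\<delta>\<in>?D. if \<delta> = wdeg w m + sh r then lookup (v r) m else 0)"
      unfolding sum_fun_apply lookup_sum by (intro sum.cong) (auto simp: vhc_def hc_def lookup_pfilter)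
    also have "\<dots> = (if wdeg w m + sh r \<in> ?D then lookup (v r) m else 0)"
      using fin by simp
    also have "\<dots> = lookup (v r) m"
    proof (cases "r < b \<and> m \<in> keys (v r)")
      case False
      then have "lookup (v r) m = 0" using free_mod_ge[OF assms, of r] by (cases "r < b") (auto simp: in_keys_iff)
      then show ?thesis by simp
    qed auto
    finally show "lookup (v r) m = lookup ((\<Sum>\<delta>\<in>?D. vhc w sh \<delta> v) r) m" by simp
  qed
qed

lemma matvec_eq_comb:
  assumes "\<And>i. i < c \<Longrightarrow> g i \<in> free_mod V b"
  shows "matvec (\<lambda>r i. g i r) b c v = (\<Sum>i<c. smul (v i) (g i))"
proof
  fix r
  show "matvec (\<lambda>r i. g i r) b c v r = (\<Sum>i<c. smul (v i) (g i)) r"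
    using free_mod_ge[OF assms, of _ r]
    by (cases "r < b") (auto simp: matvec_def sum_fun_apply smul_def mult.commute)
qed

lemma vhc_matvec:
  assumes "\<And>r i. r < b \<Longrightarrow> i < c \<Longrightarrow> homogeneous w (sh' i - sh r) (M r i)"
  shows "vhc w sh \<delta> (matvec M b c v) = matvec M b c (vhc w sh' \<delta> v)"
proof
  fix r
  have "hc w (\<delta> - sh r) (\<Sum>i<c. M r i * v i) = (\<Sum>i<c. M r i * hc w (\<delta> - sh' i) (v i))" if "r < b"
  proof -
    have "hc w (\<delta> - sh r) (\<Sum>i<c. M r i * v i) = (\<Sum>i<c. hc w (\<delta> - sh r) (M r i * v i))"
      by (simp add: hc_def pfilter_sum)
    also have "\<dots> = (\<Sum>i<c. M r i * hc w (\<delta> - sh' i) (v i))"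
    proof (intro sum.cong refl)
      fix i assume "i \<in> {..<c}"
      then show "hc w (\<delta> - sh r) (M r i * v i) = M r i * hc w (\<delta> - sh' i) (v i)"
        using hc_mult_homogeneous[OF assms[OF that, of i], of "\<delta> - sh r" "v i"] by simp
    qed
    finally show ?thesis .
  qed
  then show "vhc w sh \<delta> (matvec M b c v) r = matvec M b c (vhc w sh' \<delta> v) r"
    by (simp add: vhc_def matvec_def) (simp add: hc_def)
qed

text \<open>Generators are taken as few as possible. A syzygy with a nonzero constant term at
  \<open>i\<close> would express \<open>g i\<close> through the other generators, against
  minimality; this replaces Nakayama's lemma. The kernel is returned as a graded submodule so that
  the construction can be repeated on it.\<close>

lemma minimal_generators:
  fixes N :: "(nat \<Rightarrow> 'k::field mpoly) set"
  assumes V: "finite V" and w: "\<And>j. j \<in> V \<Longrightarrow> w j > 0" and N: "gsub w V b sh N"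
  shows "\<exists>c sh' M. (\<forall>r<b. \<forall>i<c. M r i \<in> Pring V \<and> homogeneous w (sh' i - sh r) (M r i)) \<and>
    N = matvec M b c ` free_mod V c \<and>
    gsub w V c sh' {v \<in> free_mod V c. matvec M b c v = 0} \<and>
    (\<forall>v \<in> free_mod V c. matvec M b c v = 0 \<longrightarrow> max_vec v)"
proof -
  have sN: "submod V b N" using N by (simp add: gsub_def)
  define gens where "gens G \<longleftrightarrow> finite G \<and> (\<forall>g\<in>G. g \<in> N \<and> (\<exists>\<delta>. vhom w b sh \<delta> g)) \<and> N \<subseteq> mspan V b G" for G
  have "\<exists>G. gens G"
  proof -
    obtain G where G: "finite G" "\<And>g. g \<in> G \<Longrightarrow> g \<in> N \<and> (\<exists>\<delta>. vhom w b sh \<delta> g)"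
      "\<And>v \<delta>. v \<in> N \<Longrightarrow> vhom w b sh \<delta> v \<Longrightarrow> v \<in> mspan V b G"
      using graded_submodule_finitely_generated[OF V w N] by blast
    have sG: "submod V b (mspan V b G)" using G(2) submodD(1)[OF sN] by (intro submod_mspan) blast
    have "v \<in> mspan V b G" if vN: "v \<in> N" for v
    proof -
      obtain D where D: "finite D" "v = (\<Sum>\<delta>\<in>D. vhc w sh \<delta> v)"
        using vec_sum_components[OF submodD(1)[OF sN vN]] by blast
      have "vhc w sh \<delta> v \<in> mspan V b G" for \<delta>
        using N vN by (intro G(3)[OF _ vhom_vhc]) (simp add: gsub_def)
      then show ?thesis by (subst D(2)) (rule submod_sum[OF sG])
    qed
    then have "N \<subseteq> mspan V b G" ..
    moreover have "\<forall>g\<in>G. g \<in> N \<and> (\<exists>\<delta>. vhom w b sh \<delta> g)" by (rule ballI) (rule G(2))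
    ultimately have "gens G" using G(1) unfolding gens_def by (intro conjI)
    then show ?thesis ..
  qed
  then obtain G where G: "gens G" and Gmin: "\<And>G'. gens G' \<Longrightarrow> card G \<le> card G'"
    using ex_has_least_nat[of gens _ card] by blast
  have Gfin: "finite G" and GN: "\<And>g. g \<in> G \<Longrightarrow> g \<in> N" and Ghom: "\<And>g. g \<in> G \<Longrightarrow> \<exists>\<delta>. vhom w b sh \<delta> g"
    and Gspan: "N \<subseteq> mspan V b G"
    using G unfolding gens_def by blast+
  define c where "c = card G"
  obtain g where g: "bij_betw g {..<c} G"
    using ex_bij_betw_nat_finite[OF Gfin] by (auto simp: c_def atLeast0LessThan)
  have gG: "g i \<in> G" if "i < c" for i using g that by (auto simp: bij_betw_def)
  have gfree: "g i \<in> free_mod V b" if "i < c" for i using submodD(1)[OF sN GN[OF gG[OF that]]] .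
  obtain dg where dg: "\<And>x. x \<in> G \<Longrightarrow> vhom w b sh (dg x) x" using Ghom by metis
  define sh' where "sh' i = dg (g i)" for i
  define M where "M r i = g i r" for r i
  have MP: "M r i \<in> Pring V" if "i < c" for r i
    using free_mod_Pring[OF gfree[OF that]] by (simp add: M_def)
  have Mh: "homogeneous w (sh' i - sh r) (M r i)" if "r < b" "i < c" for r i
    using dg[OF gG[OF that(2)]] that by (simp add: vhom_def M_def sh'_def)
  have mv: "matvec M b c v = (\<Sum>i<c. smul (v i) (g i))" for v
    using matvec_eq_comb[OF gfree] by (simp add: M_def[abs_def])
  have lin: "lin V c b (matvec M b c)" by (rule lin_matvec) (rule MP)
  have "N \<subseteq> matvec M b c ` free_mod V c"
  proof -
    have "x \<in> matvec M b c ` free_mod V c" if xG: "x \<in> G" for x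
    proof -
      obtain i where i: "i < c" "x = g i" using g xG by (auto simp: bij_betw_def)
      have "matvec M b c (unit_vec i) = (\<Sum>j<c. if j = i then g i else 0)"
        unfolding mv by (intro sum.cong) (auto simp: unit_vec_def)
      then have "matvec M b c (unit_vec i) = x" using i by simp
      then show ?thesis using free_mod_unit[OF i(1)] by blast
    qed
    then have "mspan V b G \<subseteq> matvec M b c ` free_mod V c"
      by (intro mspan_least submod_image lin) blast
    with Gspan show ?thesis by blast
  qed
  moreover have "matvec M b c v \<in> N" if "v \<in> free_mod V c" for v
    unfolding mv by (intro submod_sum[OF sN] submodD(4)[OF sN] free_mod_Pring[OF that] GN gG) simp
  ultimately have im: "N = matvec M b c ` free_mod V c" by blast
  have hcker: "matvec M b c (vhc w sh' \<delta> v) = 0" if "matvec M b c v = 0" for v \<delta>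
  proof -
    have "matvec M b c (vhc w sh' \<delta> v) = vhc w sh \<delta> 0"
      using vhc_matvec[where M = M and sh = sh and sh' = sh' and b = b and c = c, OF Mh, of \<delta> v] that by simp
    then show ?thesis by (simp add: vhc_def hc_def zero_fun_def)
  qed
  have ker: "gsub w V c sh' {v \<in> free_mod V c. matvec M b c v = 0}"
    unfolding gsub_def using submod_kernel[OF lin] hcker vhc_free by blast
  have "max_vec v" if v: "v \<in> free_mod V c" and v0: "matvec M b c v = 0" for v
    unfolding max_vec_def in_max_ideal_def
  proof (rule allI, rule ccontr)
    fix i assume nz: "lookup (v i) 0 \<noteq> 0"
    define a where "a = lookup (v i) 0"
    have i: "i < c" using nz free_mod_ge[OF v, of i] by (metis lookup_zero not_less)
    \<comment> \<open>The degree \<open>sh' i\<close> is that of \<open>g i\<close>, so the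
      coefficient \<open>u i\<close> has degree 0, and positive weights leave only its constant
      term. Since the matrix is homogeneous, \<open>u\<close> is again a syzygy.\<close>
    define u where "u = vhc w sh' (sh' i) v"
    have uP: "u j \<in> Pring V" for j using free_mod_Pring[OF vhc_free[OF v]] by (simp add: u_def)
    have ui: "u i = single 0 a"
    proof (rule poly_mapping_eqI)
      fix m
      show "lookup (u i) m = lookup (single 0 a) m"
      proof (cases "m = 0")
        case True
        then show ?thesis by (simp add: u_def vhc_def hc_def lookup_pfilter a_def)
      next
        case False
        have "wdeg w m \<noteq> 0" if "keys m \<subseteq> V"
        proof -
          obtain j where j: "j \<in> keys m" using False by fastforce
          have "lookup m j * w j \<le> (\<Sum>j\<in>keys m. lookup m j * w j)" by (rule member_le_sum[OF j]) auto
          moreover have "lookup m j * w j > 0" using j w[OF subsetD[OF that j]] by (simp add: in_keys_iff)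
          ultimately show ?thesis by (simp only: wdeg_def)
        qed
        then have "lookup (u i) m = 0"
          using free_mod_Pring[OF v, of i] by (auto simp: u_def vhc_def hc_def lookup_pfilter Pring_iff)
        then show ?thesis using False by (simp add: lookup_single)
      qed
    qed
    define G' where "G' = G - {g i}"
    have G'free: "G' \<subseteq> free_mod V b" using submodD(1)[OF sN GN] by (auto simp: G'_def)
    have sG': "submod V b (mspan V b G')" by (rule submod_mspan[OF G'free])
    have G'mem: "g j \<in> mspan V b G'" if "j < c" "j \<noteq> i" for j
    proof -
      have "g j \<noteq> g i" using g that i by (metis bij_betw_def inj_on_eq_iff lessThan_iff)
      then show ?thesis using gG[OF that(1)] by (intro subsetD[OF mspan_superset]) (simp add: G'_def)
    qed
    have "0 = (\<Sum>j<c. smul (u j) (g j))" using hcker[OF v0] by (simp add: mv u_def)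
    also have "\<dots> = smul (u i) (g i) + (\<Sum>j\<in>{..<c}-{i}. smul (u j) (g j))"
      using i by (intro sum.remove) auto
    finally have "smul (single 0 a) (g i) + (\<Sum>j\<in>{..<c}-{i}. smul (u j) (g j)) = 0"
      unfolding ui by (rule sym)
    then have "smul (single 0 a) (g i) = 0 - (\<Sum>j\<in>{..<c}-{i}. smul (u j) (g j))"
      by (simp only: eq_diff_eq)
    also have "\<dots> \<in> mspan V b G'"
      by (intro submod_diff[OF sG'] submodD(2)[OF sG'] submod_sum[OF sG'] submodD(4)[OF sG'] uP G'mem) auto
    finally have "smul (single 0 a) (g i) \<in> mspan V b G'" .
    then have "smul (single 0 (1/a)) (smul (single 0 a) (g i)) \<in> mspan V b G'"
      by (rule submodD(4)[OF sG' Pring_single, rotated]) simp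
    moreover have "single 0 (1/a) * single 0 a = (1 :: 'k mpoly)"
      using nz by (simp add: mult_single a_def)
    ultimately have gi: "g i \<in> mspan V b G'" by (simp only: smul_smul smul_one)
    have "G \<subseteq> mspan V b G'" using gi mspan_superset[of G' V b] unfolding G'_def by blast
    then have "mspan V b G \<subseteq> mspan V b G'" by (rule mspan_least[OF sG'])
    then have "gens G'" using Gspan Gfin GN Ghom unfolding gens_def by (auto simp: G'_def)
    then have "card G \<le> card G'" by (rule Gmin)
    moreover have "card G' < card G" unfolding G'_def using Gfin gG[OF i] by (intro card_Diff1_less)
    ultimately show False by simp
  qed
  then show ?thesis using MP Mh im ker by blast
qed

text \<open>The last clause makes the ideal proper: \<open>S\<close> itself with augmentation 1 can
  then serve as \<open>F_0\<close>, and the first differential is minimal.\<close>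

definition graded_ideal :: "(nat \<Rightarrow> nat) \<Rightarrow> nat set \<Rightarrow> 'k::field mpoly set \<Rightarrow> bool" where
  "graded_ideal w V I \<longleftrightarrow> is_ideal V I \<and> (\<forall>p\<in>I. \<forall>\<delta>. hc w \<delta> p \<in> I) \<and> (\<forall>p\<in>I. in_max_ideal p)"

text \<open>\<open>minimal_generators\<close> is applied to \<open>I\<close>, viewed inside the free
  module of rank one, then to the resulting syzygies, and so on. Dependent choice collects the
  matrices into one sequence.\<close>

theorem min_graded_free_res_exists:
  fixes I :: "'k::field mpoly set"
  assumes V: "finite V" and w: "\<And>j. j \<in> V \<Longrightarrow> w j > 0" and I: "graded_ideal w V I"
  shows "\<exists>b sh e d. min_graded_free_res w V I b sh e d"
proof -
  have idl: "is_ideal V I" and Ihc: "\<And>p \<delta>. p \<in> I \<Longrightarrow> hc w \<delta> p \<in> I" and Imax: "\<And>p. p \<in> I \<Longrightarrow> in_max_ideal p"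
    using I by (auto simp: graded_ideal_def)
  define N0 where "N0 = {v \<in> free_mod V 1. v 0 \<in> I}"
  have N0: "gsub w V 1 (\<lambda>_. 0) N0"
    unfolding gsub_def submod_def
  proof (intro conjI ballI allI)
    show "0 \<in> N0" using is_idealD(2)[OF idl] by (simp add: N0_def)
    show "v + u \<in> N0" if "v \<in> N0" "u \<in> N0" for v u
      using that is_idealD(3)[OF idl] by (auto simp: N0_def)
    show "smul s v \<in> N0" if "s \<in> Pring V" "v \<in> N0" for s v
      using that is_idealD(4)[OF idl that(1), of "v 0"] free_mod_smul[OF that(1), of v 1]
      by (auto simp: N0_def smul_def)
    show "vhc w (\<lambda>_. 0) \<delta> v \<in> N0" if "v \<in> N0" for v \<delta>
      using that Ihc vhc_free[of v V 1] by (auto simp: N0_def) (simp add: vhc_def)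
  qed (auto simp: N0_def)
  have N0max: "max_vec v" if "v \<in> N0" for v
    unfolding max_vec_def
  proof
    fix r show "in_max_ideal (v r)"
      using that Imax free_mod_ge[of v V 1 r] by (cases r) (auto simp: N0_def in_max_ideal_def)
  qed
  \<comment> \<open>The state is a rank, the shifts, and the graded submodule to be generated next.
    Generators are the columns of the next matrix, so \<open>max_vec\<close> on the submodule makes
    that matrix minimal.\<close>
  define good where "good = (\<lambda>(b, sh, N :: (nat \<Rightarrow> 'k mpoly) set). gsub w V b sh N \<and> (\<forall>v\<in>N. max_vec v))"
  define step where "step = (\<lambda>(b, sh, N :: (nat \<Rightarrow> 'k mpoly) set) (c, sh', N') M.
    (\<forall>r<b. \<forall>i<c. M r i \<in> Pring V \<and> homogeneous w (sh' i - sh r) (M r i) \<and> in_max_ideal (M r i)) \<and>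
    N = matvec M b c ` free_mod V c \<and> N' = {v \<in> free_mod V c. matvec M b c v = 0})"
  have "\<exists>f. \<forall>n. (good (f n) \<and> (n = 0 \<longrightarrow> f n = (1, \<lambda>_. 0, N0))) \<and> (\<exists>M. step (f n) (f (Suc n)) M)"
  proof (rule dependent_nat_choice)
    show "\<exists>x. good x \<and> ((0::nat) = 0 \<longrightarrow> x = (1, \<lambda>_. 0, N0))"
      using N0 N0max by (auto simp: good_def)
  next
    fix x n assume x: "good x \<and> ((n::nat) = 0 \<longrightarrow> x = (1, \<lambda>_. 0, N0))"
    obtain b sh N where xe: "x = (b, sh, N)" by (cases x)
    have N: "gsub w V b sh N" and Nmax: "\<And>v. v \<in> N \<Longrightarrow> max_vec v" using x by (auto simp: xe good_def)
    obtain c sh' M where M: "\<And>r i. r < b \<Longrightarrow> i < c \<Longrightarrow> M r i \<in> Pring V \<and> homogeneous w (sh' i - sh r) (M r i)"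
      "N = matvec M b c ` free_mod V c" "gsub w V c sh' {v \<in> free_mod V c. matvec M b c v = 0}"
      "\<And>v. v \<in> free_mod V c \<Longrightarrow> matvec M b c v = 0 \<Longrightarrow> max_vec v"
      using minimal_generators[OF V w N] by blast
    have "in_max_ideal (M r i)" if "r < b" "i < c" for r i
    proof -
      have "max_vec (matvec M b c (unit_vec i))" using M(2) free_mod_unit[OF that(2)] Nmax by blast
      moreover have "matvec M b c (unit_vec i) r = (\<Sum>j<c. if j = i then M r i else 0)"
        using that unfolding matvec_def unit_vec_def by (simp only: if_True) (rule sum.cong, auto)
      ultimately show ?thesis using that by (simp add: max_vec_def) metis
    qed
    then have "step x (c, sh', {v \<in> free_mod V c. matvec M b c v = 0}) M"
      unfolding step_def xe using M(1,2) by simp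
    moreover have "good (c, sh', {v \<in> free_mod V c. matvec M b c v = 0})"
      unfolding good_def using M(3,4) by simp
    ultimately show "\<exists>y. (good y \<and> (Suc n = 0 \<longrightarrow> y = (1, \<lambda>_. 0, N0))) \<and> (\<exists>M. step x y M)" by blast
  qed
  then obtain f where f0: "f 0 = (1, \<lambda>_. 0, N0)" and ex: "\<And>n. \<exists>M. step (f n) (f (Suc n)) M" by blast
  obtain M where M: "\<And>n. step (f n) (f (Suc n)) (M n)" using ex by metis
  define b where "b n = fst (f n)" for n
  define sh where "sh n = fst (snd (f n))" for n
  define N where "N n = snd (snd (f n))" for n
  define d where "d i = M (i - 1)" for i
  have "step (b n, sh n, N n) (b (Suc n), sh (Suc n), N (Suc n)) (d (Suc n))" for n
    using M[of n] by (simp add: b_def sh_def N_def d_def)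
  then have dd: "\<And>n r i. r < b n \<Longrightarrow> i < b (Suc n) \<Longrightarrow> d (Suc n) r i \<in> Pring V \<and>
      homogeneous w (sh (Suc n) i - sh n r) (d (Suc n) r i) \<and> in_max_ideal (d (Suc n) r i)"
    and Nim: "\<And>n. N n = matvec (d (Suc n)) (b n) (b (Suc n)) ` free_mod V (b (Suc n))"
    and Nker: "\<And>n. N (Suc n) = {v \<in> free_mod V (b (Suc n)). matvec (d (Suc n)) (b n) (b (Suc n)) v = 0}"
    unfolding step_def prod.case by blast+
  have b0: "b 0 = 1" and sh0: "sh 0 = (\<lambda>_. 0)" and Nz: "N 0 = N0"
    by (simp_all add: b_def sh_def N_def f0)
  have pos: "(\<forall>i\<ge>1. P i) \<longleftrightarrow> (\<forall>i. P (Suc i))" for P :: "nat \<Rightarrow> bool"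
    by (metis One_nat_def Suc_le_D Suc_le_mono le0)
  have "min_graded_free_res w V I b sh (\<lambda>_. 1) d"
    unfolding min_graded_free_res_def pos
  proof (intro conjI allI impI ballI)
    fix f :: "'k mpoly" assume f: "f \<in> Pring V"
    show "\<exists>v\<in>free_mod V (b 0). (\<Sum>j<b 0. 1 * v j) - f \<in> I"
      by (rule bexI[of _ "\<lambda>r. if r = 0 then f else 0"])
        (use f is_idealD(2)[OF idl] in \<open>auto simp: b0 free_mod_def\<close>)
  next
    show "{v \<in> free_mod V (b 0). (\<Sum>j<b 0. 1 * v j) \<in> I} = matvec (d 1) (b 0) (b 1) ` free_mod V (b 1)"
      using Nim[of 0] by (simp add: b0 Nz N0_def)
  next
    fix i
    show "{v \<in> free_mod V (b (Suc i)). matvec (d (Suc i)) (b (Suc i - 1)) (b (Suc i)) v = (\<lambda>_. 0)} =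
         matvec (d (Suc (Suc i))) (b (Suc i)) (b (Suc (Suc i))) ` free_mod V (b (Suc (Suc i)))"
      using Nim[of "Suc i"] Nker[of i] by (simp add: zero_fun_def)
  qed (use dd in \<open>auto simp: b0 sh0 homogeneous_def\<close>)
  then show ?thesis by blast
qed

section \<open>Toric ideals and fibre sums\<close>

definition ev :: "(nat \<Rightarrow> nat) \<Rightarrow> (nat \<Rightarrow>\<^sub>0 nat) \<Rightarrow> nat" where
  "ev f m = (\<Sum>j\<in>keys m. lookup m j * f j)"

lemma ev_plus: "ev f (m + m') = ev f m + ev f m'"
  by (simp add: ev_def ev_add)

lemma ev_zero [simp]: "ev f 0 = 0"
  by (simp add: ev_def)

lemma ev_single [simp]: "ev f (single j c) = c * f j"
  by (simp add: ev_def)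

lemma ev_superset: "keys m \<subseteq> A \<Longrightarrow> finite A \<Longrightarrow> ev f m = (\<Sum>j\<in>A. lookup m j * f j)"
  unfolding ev_def by (rule sum.mono_neutral_left) (auto simp: in_keys_iff)

lemma wdeg_ev: "wdeg w m = int (ev w m)"
  by (simp add: wdeg_def ev_def)

lemma mon_img_ev: "mon_img a d m = single 0 (ev a m) + single 1 (ev (\<lambda>i. d - a i) m)"
  by (simp add: mon_img_def ev_def)

lemma mon_img1_ev: "mon_img1 a m = single 0 (ev a m)"
  by (simp add: mon_img1_def ev_def)

lemma mon_img_add: "mon_img a d (m + m') = mon_img a d m + mon_img a d m'"
  by (simp add: mon_img_ev ev_plus single_add algebra_simps)

lemma mon_img1_add: "mon_img1 a (m + m') = mon_img1 a m + mon_img1 a m'"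
  by (simp add: mon_img1_ev ev_plus single_add)

lemma mon_img_eq_iff:
  "mon_img a d m = mon_img a d m' \<longleftrightarrow>
    ev a m = ev a m' \<and> ev (\<lambda>i. d - a i) m = ev (\<lambda>i. d - a i) m'"
proof
  assume eq: "mon_img a d m = mon_img a d m'"
  show "ev a m = ev a m' \<and> ev (\<lambda>i. d - a i) m = ev (\<lambda>i. d - a i) m'"
    using arg_cong[OF eq, of "\<lambda>p. lookup p 0"] arg_cong[OF eq, of "\<lambda>p. lookup p 1"]
    by (simp add: mon_img_ev lookup_add lookup_single)
qed (simp add: mon_img_ev)

lemma mon_img1_eq_iff: "mon_img1 a m = mon_img1 a m' \<longleftrightarrow> ev a m = ev a m'"
  unfolding mon_img1_ev by (metis lookup_single_eq)

lemma subst_mon_superset: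
  assumes "keys p \<subseteq> A" "finite A"
  shows "subst_mon \<phi> p = (\<Sum>m\<in>A. single (\<phi> m) (lookup p m))"
  unfolding subst_mon_def using assms by (intro sum.mono_neutral_left) (auto simp: in_keys_iff)

lemma subst_mon_add: "subst_mon \<phi> (p + q) = subst_mon \<phi> p + subst_mon \<phi> q"
proof -
  let ?A = "keys p \<union> keys q"
  have "keys (p + q) \<subseteq> ?A" by (rule keys_add)
  then show ?thesis
    by (simp add: subst_mon_superset[of _ ?A] lookup_add single_add sum.distrib)
qed

lemma subst_mon_single: "subst_mon \<phi> (single m c) = single (\<phi> m) c"
  by (simp add: subst_mon_def)

lemma subst_mon_zero [simp]: "subst_mon \<phi> 0 = 0"
  by (simp add: subst_mon_def)

lemma subst_mon_sum: "subst_mon \<phi> (sum f A) = (\<Sum>i\<in>A. subst_mon \<phi> (f i))"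
  by (induction A rule: infinite_finite_induct) (auto simp: subst_mon_add)

lemma subst_mon_diff: "subst_mon \<phi> (p - q) = subst_mon \<phi> p - subst_mon \<phi> q"
  using subst_mon_add[of \<phi> "p - q" q] by (simp add: algebra_simps)

lemma subst_mon_mult:
  assumes "\<And>m m'. \<phi> (m + m') = \<phi> m + \<phi> m'"
  shows "subst_mon \<phi> (p * q) = subst_mon \<phi> p * subst_mon \<phi> q"
proof -
  have "p * q = (\<Sum>m\<in>keys p. single m (lookup p m)) * (\<Sum>m\<in>keys q. single m (lookup q m))"
    using poly_mapping_sum_single[of p] poly_mapping_sum_single[of q] by metis
  also have "\<dots> = (\<Sum>m\<in>keys p. \<Sum>m'\<in>keys q. single (m + m') (lookup p m * lookup q m'))"
    by (simp add: sum_product mult_single)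
  finally show ?thesis
    unfolding subst_mon_def[of \<phi> p] subst_mon_def[of \<phi> q]
    by (simp add: subst_mon_sum subst_mon_single assms sum_product mult_single)
qed

lemma lookup_subst_mon:
  "lookup (subst_mon \<phi> p) \<mu> = (\<Sum>m\<in>keys p. if \<phi> m = \<mu> then lookup p m else 0)"
  unfolding subst_mon_def lookup_sum by (intro sum.cong) (auto simp: lookup_single when_def)

lemma lookup_subst_mon_zero:
  "(\<And>m. m \<in> keys p \<Longrightarrow> \<phi> m \<noteq> \<mu>) \<Longrightarrow> lookup (subst_mon \<phi> p) \<mu> = 0"
  by (simp add: lookup_subst_mon)

text \<open>\<open>fib V \<phi> UNIV\<close> is the kernel of the monomial substitution \<open>\<phi>\<close>.  Setting a variable to
  zero only removes from \<open>B\<close> the target monomials that are hit by a multiple of that variable.\<close>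

definition fib :: "nat set \<Rightarrow> ((nat \<Rightarrow>\<^sub>0 nat) \<Rightarrow> (nat \<Rightarrow>\<^sub>0 nat)) \<Rightarrow> (nat \<Rightarrow>\<^sub>0 nat) set \<Rightarrow> 'k::field mpoly set" where
  "fib V \<phi> B = {p \<in> Pring V. \<forall>\<mu>\<in>B. lookup (subst_mon \<phi> p) \<mu> = 0}"

lemma toric_ideal_fib: "toric_ideal a d n = fib {0..n} (mon_img a d) UNIV"
  by (auto simp: toric_ideal_def fib_def intro!: poly_mapping_eqI)

lemma toric_ideal1_fib: "toric_ideal1 a n = fib {1..n} (mon_img1 a) UNIV"
  by (auto simp: toric_ideal1_def fib_def intro!: poly_mapping_eqI)

lemma is_ideal_fib:
  assumes "\<And>m m'. \<phi> (m + m') = \<phi> m + \<phi> m'"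
  shows "is_ideal V (fib V \<phi> UNIV)"
proof -
  have 0: "p \<in> fib V \<phi> UNIV \<longleftrightarrow> p \<in> Pring V \<and> subst_mon \<phi> p = 0" for p :: "'a mpoly"
    by (auto simp: fib_def intro!: poly_mapping_eqI)
  show ?thesis
    unfolding is_ideal_def
    by (auto simp: 0 subst_mon_add subst_mon_mult[OF assms] intro: Pring_add Pring_mult)
qed

text \<open>The degree can be read off the image by \<open>D\<close>, so each fibre lies in a single
  degree and a fibre sum involves only one homogeneous component. The fibre over
  \<open>\<phi> 0\<close> is the single monomial 1, whose coefficient must then vanish.\<close>

lemma graded_ideal_fib:
  assumes add: "\<And>m m'. \<phi> (m + m') = \<phi> m + \<phi> m'"
    and deg: "\<And>m. keys m \<subseteq> V \<Longrightarrow> wdeg w m = D (\<phi> m)"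
    and inj0: "\<And>m. keys m \<subseteq> V \<Longrightarrow> \<phi> m = \<phi> 0 \<Longrightarrow> m = 0"
  shows "graded_ideal w V (fib V \<phi> UNIV)"
  unfolding graded_ideal_def
proof (intro conjI ballI allI is_ideal_fib add)
  fix p :: "'a mpoly" assume p: "p \<in> fib V \<phi> UNIV"
  then have pV: "\<And>m. m \<in> keys p \<Longrightarrow> keys m \<subseteq> V" by (simp add: fib_def Pring_def)
  have p0: "lookup (subst_mon \<phi> p) \<mu> = 0" for \<mu> using p by (simp add: fib_def)
  show "hc w \<delta> p \<in> fib V \<phi> UNIV" for \<delta>
    unfolding fib_def
  proof (intro CollectI conjI ballI)
    show "hc w \<delta> p \<in> Pring V" using p by (auto simp: fib_def hc_def)
    fix \<mu>
    show "lookup (subst_mon \<phi> (hc w \<delta> p)) \<mu> = 0"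
    proof (cases "D \<mu> = \<delta>")
      case True
      have "subst_mon \<phi> (hc w \<delta> p) = (\<Sum>m\<in>keys p. single (\<phi> m) (lookup (hc w \<delta> p) m))"
        by (rule subst_mon_superset) (auto simp: hc_def keys_pfilter)
      then have "lookup (subst_mon \<phi> (hc w \<delta> p)) \<mu> = lookup (subst_mon \<phi> p) \<mu>"
        unfolding lookup_subst_mon[of \<phi> p] using True deg pV
        by (auto simp: lookup_sum lookup_single when_def hc_def lookup_pfilter intro!: sum.cong)
      then show ?thesis using p0 by simp
    next
      case False
      then show ?thesis
        by (intro lookup_subst_mon_zero) (use deg pV in \<open>auto simp: hc_def keys_pfilter\<close>)
    qed
  qed
  have "0 = lookup (subst_mon \<phi> p) (\<phi> 0)" using p0 by simp
  also have "\<dots> = (\<Sum>m\<in>keys p. if m = 0 then lookup p 0 else 0)"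
    unfolding lookup_subst_mon using inj0 pV by (intro sum.cong) auto
  also have "\<dots> = lookup p 0" by (simp add: in_keys_iff)
  finally show "in_max_ideal p" by (simp add: in_max_ideal_def)
qed

text \<open>A fibre containing a multiple of \<open>x\<close> imposes no condition after
  \<open>x\<close> is set to zero: its coefficient sum can be repaired by a term that
  \<open>rho x\<close> kills. A fibre without such a multiple keeps all its coefficients, hence its
  condition.\<close>

lemma rho_fib:
  fixes V :: "nat set"
  defines "hit x \<mu> \<equiv> \<lambda>\<phi>. \<exists>m. keys m \<subseteq> V \<and> lookup m x > 0 \<and> \<phi> m = \<mu>"
  shows "rho x ` fib V \<phi> B = (fib (V - {x}) \<phi> {\<mu>\<in>B. \<not> hit x \<mu> \<phi>} :: 'k::field mpoly set)"
proof (intro equalityI subsetI)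
  fix q :: "'k mpoly" assume "q \<in> rho x ` fib V \<phi> B"
  then obtain p where p: "p \<in> fib V \<phi> B" "q = rho x p" by blast
  have pV: "p \<in> Pring V" using p by (simp add: fib_def)
  show "q \<in> fib (V - {x}) \<phi> {\<mu>\<in>B. \<not> hit x \<mu> \<phi>}"
    unfolding fib_def
  proof (intro CollectI conjI ballI)
    show "q \<in> Pring (V - {x})" using rho_Pring[OF pV] p by simp
    fix \<mu> assume \<mu>: "\<mu> \<in> {\<mu>\<in>B. \<not> hit x \<mu> \<phi>}"
    have "lookup (subst_mon \<phi> (p - q)) \<mu> = 0"
    proof (rule lookup_subst_mon_zero)
      fix m assume "m \<in> keys (p - q)"
      then have "lookup m x > 0" "m \<in> keys p"
        by (auto simp: p(2) rho_def in_keys_iff lookup_minus lookup_pfilter split: if_splits)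
      moreover from this have "keys m \<subseteq> V" using pV unfolding Pring_def by blast
      ultimately show "\<phi> m \<noteq> \<mu>" using \<mu> unfolding hit_def by blast
    qed
    then show "lookup (subst_mon \<phi> q) \<mu> = 0"
      using p(1) \<mu> by (simp add: subst_mon_diff lookup_minus fib_def)
  qed
next
  fix q :: "'k mpoly" assume q: "q \<in> fib (V - {x}) \<phi> {\<mu>\<in>B. \<not> hit x \<mu> \<phi>}"
  have qV: "q \<in> Pring (V - {x})" using q by (simp add: fib_def)
  define T where "T = {\<mu> \<in> \<phi> ` keys q. hit x \<mu> \<phi>}"
  have "finite T" by (simp add: T_def)
  have "\<forall>\<mu>. \<exists>m. hit x \<mu> \<phi> \<longrightarrow> keys m \<subseteq> V \<and> lookup m x > 0 \<and> \<phi> m = \<mu>"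
    unfolding hit_def by blast
  from choice[OF this] obtain r where
    r: "\<And>\<mu>. hit x \<mu> \<phi> \<Longrightarrow> keys (r \<mu>) \<subseteq> V \<and> lookup (r \<mu>) x > 0 \<and> \<phi> (r \<mu>) = \<mu>"
    by blast
  have rT: "keys (r \<mu>) \<subseteq> V" "lookup (r \<mu>) x \<noteq> 0" "\<phi> (r \<mu>) = \<mu>" if "\<mu> \<in> T" for \<mu>
    using r[of \<mu>] that by (auto simp: T_def)
  \<comment> \<open>For each hit fibre in the image of \<open>q\<close>, the chosen multiple
    \<open>r \<mu>\<close> of the variable carries the whole fibre sum of \<open>q\<close>;
    subtracting \<open>s\<close> makes these sums zero without changing the reduction.\<close>
  define s where "s = (\<Sum>\<mu>\<in>T. single (r \<mu>) (lookup (subst_mon \<phi> q) \<mu>))"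
  have "rho x s = 0"
    unfolding s_def rho_sum by (intro sum.neutral) (simp add: rho_def pfilter_single rT(2))
  then have "q = rho x (q - s)" using rho_id[OF qV] by (simp add: rho_diff)
  moreover have "q - s \<in> fib V \<phi> B"
    unfolding fib_def
  proof (intro CollectI conjI ballI)
    have "s \<in> Pring V" unfolding s_def by (intro Pring_sum Pring_single rT(1))
    then show "q - s \<in> Pring V" using Pring_mono[OF _ qV, of V] by auto
    fix \<nu> assume \<nu>: "\<nu> \<in> B"
    have "lookup (subst_mon \<phi> s) \<nu> = (\<Sum>\<mu>\<in>T. if \<mu> = \<nu> then lookup (subst_mon \<phi> q) \<nu> else 0)"
      unfolding s_def subst_mon_sum lookup_sum
      by (intro sum.cong) (auto simp: subst_mon_single rT(3) lookup_single when_def)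
    also have "\<dots> = (if \<nu> \<in> T then lookup (subst_mon \<phi> q) \<nu> else 0)"
      using \<open>finite T\<close> by simp
    also have "\<dots> = lookup (subst_mon \<phi> q) \<nu>"
    proof (cases "\<nu> \<in> T")
      case False
      have "lookup (subst_mon \<phi> q) \<nu> = 0"
      proof (cases "hit x \<nu> \<phi>")
        case True
        then show ?thesis using False by (intro lookup_subst_mon_zero) (auto simp: T_def)
      next
        case False
        then show ?thesis using q \<nu> by (simp add: fib_def)
      qed
      then show ?thesis by simp
    qed simp
    finally show "lookup (subst_mon \<phi> (q - s)) \<nu> = 0" by (simp add: subst_mon_diff lookup_minus)
  qed
  ultimately show "q \<in> rho x ` fib V \<phi> B" by blast
qed

text \<open>Multiplying by the variable moves the fibre sum at \<open>\<mu>\<close> to the target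
  \<open>\<phi> (single x 1) + \<mu>\<close>. Stability of \<open>B\<close> under this translation
  makes the condition there available.\<close>

lemma fib_nonzerodivisor:
  assumes add: "\<And>m m'. \<phi> (m + m') = \<phi> m + \<phi> m'"
    and B: "\<And>m. keys m \<subseteq> V \<Longrightarrow> \<phi> m \<in> B \<Longrightarrow> \<phi> (single x 1) + \<phi> m \<in> B"
    and f: "f \<in> Pring V" and xf: "var x * f \<in> fib V \<phi> B"
  shows "f \<in> fib V \<phi> B"
  unfolding fib_def
proof (intro CollectI conjI ballI f)
  fix \<mu> assume "\<mu> \<in> B"
  show "lookup (subst_mon \<phi> f) \<mu> = 0"
  proof (cases "\<exists>m\<in>keys f. \<phi> m = \<mu>")
    case True
    then have "\<phi> (single x 1) + \<mu> \<in> B" using B f \<open>\<mu> \<in> B\<close> by (auto simp: Pring_def)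
    then have "0 = lookup (subst_mon \<phi> (var x * f)) (\<phi> (single x 1) + \<mu>)" using xf by (simp add: fib_def)
    also have "subst_mon \<phi> (var x * f) = single (\<phi> (single x 1)) 1 * subst_mon \<phi> f"
      by (simp add: subst_mon_mult[OF add] var_def subst_mon_single)
    also have "lookup \<dots> (\<phi> (single x 1) + \<mu>) = lookup (subst_mon \<phi> f) \<mu>"
      by (simp add: lookup_single_mult)
    finally show ?thesis by simp
  qed (auto intro: lookup_subst_mon_zero)
qed

text \<open>Over \<open>B'\<close> both maps identify the same monomials, so the two fibre sums have
  the same terms. Equality of two such ideals follows by exchanging the roles of the maps.\<close>

lemma fib_subset:
  assumes B: "\<And>m. keys m \<subseteq> V \<Longrightarrow> \<psi> m \<in> B' \<Longrightarrow> \<phi> m \<in> B"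
    and eq: "\<And>m m'. keys m \<subseteq> V \<Longrightarrow> keys m' \<subseteq> V \<Longrightarrow> \<psi> m \<in> B' \<Longrightarrow> \<phi> m' = \<phi> m \<longleftrightarrow> \<psi> m' = \<psi> m"
  shows "fib V \<phi> B \<subseteq> fib V \<psi> B'"
proof
  fix p :: "'k::field mpoly" assume p: "p \<in> fib V \<phi> B"
  show "p \<in> fib V \<psi> B'"
    unfolding fib_def
  proof (intro CollectI conjI ballI)
    show "p \<in> Pring V" using p by (simp add: fib_def)
    then have pV: "\<And>m. m \<in> keys p \<Longrightarrow> keys m \<subseteq> V" by (simp add: Pring_def)
    fix \<mu> assume \<mu>: "\<mu> \<in> B'"
    show "lookup (subst_mon \<psi> p) \<mu> = 0"
    proof (cases "\<exists>m\<in>keys p. \<psi> m = \<mu>")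
      case True
      then obtain m where m: "m \<in> keys p" "\<psi> m = \<mu>" by blast
      have "lookup (subst_mon \<psi> p) \<mu> = lookup (subst_mon \<phi> p) (\<phi> m)"
        unfolding lookup_subst_mon using eq[OF pV[OF m(1)] pV] m(2) \<mu> by (intro sum.cong) auto
      also have "\<dots> = 0" using p B[OF pV[OF m(1)]] m(2) \<mu> by (simp add: fib_def)
      finally show ?thesis .
    qed (auto intro: lookup_subst_mon_zero)
  qed
qed

section \<open>The Apery sets\<close>

lemma S1_add: "y \<in> S1 a n \<Longrightarrow> z \<in> S1 a n \<Longrightarrow> y + z \<in> S1 a n"
proof -
  assume "y \<in> S1 a n" "z \<in> S1 a n"
  then obtain c c' where "y = (\<Sum>i\<in>{1..n}. c i * a i)" "z = (\<Sum>i\<in>{1..n}. c' i * a i)"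
    by (auto simp: S1_def)
  then have "y + z = (\<Sum>i\<in>{1..n}. (c i + c' i) * a i)" by (simp add: distrib_right sum.distrib)
  then show ?thesis unfolding S1_def by (intro CollectI exI[of _ "\<lambda>i. c i + c' i"])
qed

lemma SS_add:
  assumes "(y, z) \<in> SS a d n" "(y', z') \<in> SS a d n"
  shows "(y + y', z + z') \<in> SS a d n"
proof -
  from assms obtain c c' where
    "y = (\<Sum>i\<in>{0..n}. c i * a i)" "z = (\<Sum>i\<in>{0..n}. c i * (d - a i))"
    "y' = (\<Sum>i\<in>{0..n}. c' i * a i)" "z' = (\<Sum>i\<in>{0..n}. c' i * (d - a i))"
    by (auto simp: SS_def)
  then have "y + y' = (\<Sum>i\<in>{0..n}. (c i + c' i) * a i)" "z + z' = (\<Sum>i\<in>{0..n}. (c i + c' i) * (d - a i))"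
    by (simp_all add: distrib_right sum.distrib)
  then show ?thesis unfolding SS_def by (intro CollectI exI[of _ "\<lambda>i. c i + c' i"]) simp
qed

lemma SS_iff: "(y, z) \<in> SS a d n \<longleftrightarrow> (\<exists>m. keys m \<subseteq> {0..n} \<and> y = ev a m \<and> z = ev (\<lambda>i. d - a i) m)"
proof
  assume "(y, z) \<in> SS a d n"
  then obtain c where c: "y = (\<Sum>i\<in>{0..n}. c i * a i)" "z = (\<Sum>i\<in>{0..n}. c i * (d - a i))"
    by (auto simp: SS_def)
  define m where "m = (\<Sum>i\<in>{0..n}. single i (c i))"
  have l: "lookup m i = (if i \<in> {0..n} then c i else 0)" for i
    by (simp add: m_def lookup_sum lookup_single when_def)
  then have k: "keys m \<subseteq> {0..n}" by (metis in_keys_iff subsetI)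
  show "\<exists>m. keys m \<subseteq> {0..n} \<and> y = ev a m \<and> z = ev (\<lambda>i. d - a i) m"
    using k c l by (intro exI[of _ m]) (auto simp: ev_superset[OF k])
qed (auto simp: SS_def ev_superset)

lemma S1_iff: "y \<in> S1 a n \<longleftrightarrow> (\<exists>m. keys m \<subseteq> {1..n} \<and> y = ev a m)"
proof
  assume "y \<in> S1 a n"
  then obtain c where c: "y = (\<Sum>i\<in>{1..n}. c i * a i)" by (auto simp: S1_def)
  define m where "m = (\<Sum>i\<in>{1..n}. single i (c i))"
  have l: "lookup m i = (if i \<in> {1..n} then c i else 0)" for i
    by (simp add: m_def lookup_sum lookup_single when_def)
  then have k: "keys m \<subseteq> {1..n}" by (metis in_keys_iff subsetI)
  show "\<exists>m. keys m \<subseteq> {1..n} \<and> y = ev a m"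
    using k c l by (intro exI[of _ m]) (auto simp: ev_superset[OF k])
qed (auto simp: S1_def ev_superset)

lemma ex_monomial_split:
  fixes P :: "(nat \<Rightarrow>\<^sub>0 nat) \<Rightarrow> bool"
  shows "(\<exists>m. keys m \<subseteq> W \<and> lookup m x > 0 \<and> P m) \<longleftrightarrow> (x \<in> W \<and> (\<exists>m. keys m \<subseteq> W \<and> P (single x 1 + m)))"
proof
  assume "\<exists>m. keys m \<subseteq> W \<and> lookup m x > 0 \<and> P m"
  then obtain m where m: "keys m \<subseteq> W" "lookup m x > 0" "P m" by blast
  have "single x 1 + (m - single x 1) = m"
    using m(2) by (intro poly_mapping_eqI) (auto simp: lookup_add lookup_minus lookup_single when_def)
  moreover have "keys (m - single x 1) \<subseteq> W" using m(1) by (auto simp: in_keys_iff lookup_minus)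
  moreover have "x \<in> W" using m(1,2) by (auto simp: in_keys_iff)
  ultimately show "x \<in> W \<and> (\<exists>m. keys m \<subseteq> W \<and> P (single x 1 + m))" using m(3) by metis
next
  assume "x \<in> W \<and> (\<exists>m. keys m \<subseteq> W \<and> P (single x 1 + m))"
  then obtain m where m: "x \<in> W" "keys m \<subseteq> W" "P (single x 1 + m)" by blast
  then show "\<exists>m. keys m \<subseteq> W \<and> lookup m x > 0 \<and> P m"
    by (intro exI[of _ "single x 1 + m"]) (auto simp: keys_add_nat lookup_add)
qed

locale projective_curve =
  fixes a :: "nat \<Rightarrow> nat" and d n :: nat
  assumes d_pos: "d \<ge> 1" and a0: "a 0 = 0" and an: "a n = d"
    and a_mono: "\<And>i j. i < j \<Longrightarrow> j \<le> n \<Longrightarrow> a i < a j"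
begin

lemma n_pos: "0 < n"
  using d_pos a0 an by (cases n) auto

lemma a_pos: "0 < i \<Longrightarrow> i \<le> n \<Longrightarrow> 0 < a i"
  using a_mono[of 0 i] by simp

lemma a_less: "i < n \<Longrightarrow> a i < d"
  using a_mono[of i n] an by simp

lemma gen_SS: "i \<le> n \<Longrightarrow> (a i, d - a i) \<in> SS a d n"
  unfolding SS_iff by (intro exI[of _ "single i 1"]) simp

lemma gen_S1: "0 < i \<Longrightarrow> i \<le> n \<Longrightarrow> a i \<in> S1 a n"
  unfolding S1_iff by (intro exI[of _ "single i 1"]) simp

lemma SS_add_an: "(y, z) \<in> SS a d n \<Longrightarrow> (y + d, z) \<in> SS a d n"
  using SS_add[of y z a d n "a n" "d - a n"] gen_SS[of n] an by simp

lemma d_S1: "d \<in> S1 a n"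
  using gen_S1[of n] n_pos an by simp

lemma SS_fst: "(y, z) \<in> SS a d n \<Longrightarrow> y \<in> S1 a n"
  by (auto simp: SS_def S1_def sum.atLeast_Suc_atMost a0)

lemma S1_lift: "y \<in> S1 a n \<Longrightarrow> \<exists>z. (y, z) \<in> SS a d n"
proof -
  assume "y \<in> S1 a n"
  then obtain m where m: "keys m \<subseteq> {1..n}" "y = ev a m" unfolding S1_iff by blast
  have "keys m \<subseteq> {0..n}" using m(1) by (rule order_trans) auto
  with m(2) show ?thesis unfolding SS_iff by blast
qed

text \<open>The least possible second coordinate works: it excludes subtracting
  \<open>(0, d)\<close>, and subtracting \<open>(d, 0)\<close> would put \<open>y - d\<close> into
  \<open>S1\<close> by projection.\<close>

lemma Ap1_lift:
  assumes "y \<in> Ap1 a d n"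
  shows "\<exists>z. (y, z) \<in> APS a d n"
proof -
  have y: "y \<in> S1 a n" "\<not> (d \<le> y \<and> y - d \<in> S1 a n)" using assms by (auto simp: Ap1_def)
  define z where "z = (LEAST z. (y, z) \<in> SS a d n)"
  have z: "(y, z) \<in> SS a d n" unfolding z_def using S1_lift[OF y(1)] by (rule LeastI_ex)
  have "\<not> (d \<le> z \<and> (y, z - d) \<in> SS a d n)"
  proof
    assume *: "d \<le> z \<and> (y, z - d) \<in> SS a d n"
    then have "z \<le> z - d" unfolding z_def by (intro Least_le) (simp add: z_def)
    then show False using * d_pos by linarith
  qed
  then show ?thesis using z y(2) SS_fst by (auto simp: APS_def)
qed

text \<open>Since \<open>d\<close> lies in \<open>S1\<close>, so does
  \<open>y + (k - 1) * d\<close>, which is \<open>y' - d\<close>.\<close>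

lemma Ap1_less_contra:
  assumes "y \<in> Ap1 a d n" "y' \<in> Ap1 a d n" "y' = y + k * d" "k > 0"
  shows False
proof -
  obtain l where k: "k = Suc l" using assms(4) by (cases k) auto
  have "y + l * d \<in> S1 a n"
  proof (induction l)
    case 0 then show ?case using assms(1) by (simp add: Ap1_def)
  next
    case (Suc l) then show ?case using S1_add[OF Suc d_S1] by (simp add: algebra_simps)
  qed
  moreover have "y' - d = y + l * d" "d \<le> y'" using assms(3) k by simp_all
  ultimately show False using assms(2) by (simp add: Ap1_def)
qed

text \<open>If \<open>k \<noteq> k'\<close>, moving the smaller multiple across leads to
  \<open>Ap1_less_contra\<close>. This is the uniqueness of Apery representatives modulo
  \<open>d\<close>, written with multiples on both sides to stay within the naturals.\<close>

lemma Ap1_residue_unique: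
  assumes "y \<in> Ap1 a d n" "y' \<in> Ap1 a d n" "y + k * d = y' + k' * d"
  shows "y = y' \<and> k = k'"
proof -
  have "k = k'"
  proof (rule ccontr)
    assume "k \<noteq> k'"
    then consider "k < k'" | "k' < k" by linarith
    then show False
    proof cases
      case 1
      then have "k' * d = k * d + (k' - k) * d" by (simp add: add_mult_distrib[symmetric])
      then have "y = y' + (k' - k) * d" using assms(3) by simp
      then show False using Ap1_less_contra[OF assms(2,1), of "k' - k"] 1 by simp
    next
      case 2
      then have "k * d = k' * d + (k - k') * d" by (simp add: add_mult_distrib[symmetric])
      then have "y' = y + (k - k') * d" using assms(3) by simp
      then show False using Ap1_less_contra[OF assms(1,2), of "k - k'"] 2 by simp
    qed
  qed
  then show ?thesis using assms(3) by simp
qed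

lemma finite_Ap1: "finite (Ap1 a d n)"
proof (rule finite_imageD)
  show "finite ((\<lambda>y. y mod d) ` Ap1 a d n)"
    by (rule finite_subset[of _ "{..<d}"]) (use d_pos in auto)
  show "inj_on (\<lambda>y. y mod d) (Ap1 a d n)"
  proof (rule inj_onI)
    fix y y' assume y: "y \<in> Ap1 a d n" "y' \<in> Ap1 a d n" "y mod d = y' mod d"
    have "y + (y' div d) * d = y' + (y div d) * d"
      using div_mult_mod_eq[of y d] div_mult_mod_eq[of y' d] y(3) by linarith
    then show "y = y'" using Ap1_residue_unique[OF y(1,2)] by blast
  qed
qed

text \<open>If \<open>(0, d)\<close> or \<open>(d, 0)\<close> could be subtracted from a summand, it
  could be subtracted from the sum: the Apery set is a down-set.\<close>

lemma APS_lower: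
  assumes "(y, z) \<in> SS a d n" "(y', z') \<in> SS a d n" "(y + y', z + z') \<in> APS a d n"
  shows "(y, z) \<in> APS a d n"
proof -
  have "\<not> (d \<le> z \<and> (y, z - d) \<in> SS a d n)"
  proof
    assume "d \<le> z \<and> (y, z - d) \<in> SS a d n"
    then have "d \<le> z + z'" "(y + y', z + z' - d) \<in> SS a d n"
      using SS_add[of y "z - d" a d n y' z'] assms(2) by auto
    then show False using assms(3) by (auto simp: APS_def)
  qed
  moreover have "\<not> (d \<le> y \<and> (y - d, z) \<in> SS a d n)"
  proof
    assume "d \<le> y \<and> (y - d, z) \<in> SS a d n"
    then have "d \<le> y + y'" "(y + y' - d, z + z') \<in> SS a d n"
      using SS_add[of "y - d" z a d n y' z'] assms(2) by auto
    then show False using assms(3) by (auto simp: APS_def)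
  qed
  ultimately show ?thesis using assms(1) by (simp add: APS_def)
qed

lemma Ap1_lower:
  assumes "y \<in> S1 a n" "y' \<in> S1 a n" "y + y' \<in> Ap1 a d n"
  shows "y \<in> Ap1 a d n"
proof -
  have "\<not> (d \<le> y \<and> y - d \<in> S1 a n)"
  proof
    assume "d \<le> y \<and> y - d \<in> S1 a n"
    then have "d \<le> y + y'" "y + y' - d \<in> S1 a n" using S1_add[of "y - d" a n y'] assms(2) by auto
    then show False using assms(3) by (simp add: Ap1_def)
  qed
  then show ?thesis using assms(1) by (simp add: Ap1_def)
qed

text \<open>Both coordinates are strictly below \<open>d\<close>, so neither subtraction is
  possible.\<close>

lemma gen_APS: "0 < i \<Longrightarrow> i < n \<Longrightarrow> (a i, d - a i) \<in> APS a d n"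
  using gen_SS[of i] a_pos[of i] a_less[of i] by (auto simp: APS_def)

lemma zero_APS: "(0, 0) \<in> APS a d n"
  using d_pos by (auto simp: APS_def SS_def intro: exI[of _ "\<lambda>_. 0"])

text \<open>Only \<open>(d, 0)\<close> is subtracted, so the second coordinate is kept. The
  hypothesis on \<open>(0, d)\<close> survives each subtraction, because adding
  \<open>(d, 0)\<close> back would violate it before.\<close>

lemma SS_decompose_an:
  assumes "(y, z) \<in> SS a d n" "\<not> (d \<le> z \<and> (y, z - d) \<in> SS a d n)"
  shows "\<exists>y' k. (y', z) \<in> APS a d n \<and> y = y' + k * d"
  using assms
proof (induction y rule: less_induct)
  case (less y)
  show ?case
  proof (cases "d \<le> y \<and> (y - d, z) \<in> SS a d n")
    case True
    have "\<not> (d \<le> z \<and> (y - d, z - d) \<in> SS a d n)"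
      using less.prems(2) SS_add_an[of "y - d" "z - d"] True by auto
    moreover have "y - d < y" using True d_pos by simp
    ultimately obtain y' k where "(y', z) \<in> APS a d n" "y - d = y' + k * d"
      using less.IH[of "y - d"] True by blast
    then show ?thesis using True by (intro exI[of _ y'] exI[of _ "Suc k"]) auto
  next
    case False
    then have "(y, z) \<in> APS a d n" using less.prems by (simp add: APS_def)
    then show ?thesis by (intro exI[of _ y] exI[of _ 0]) simp
  qed
qed

lemma SS_decompose:
  assumes "(y, z) \<in> SS a d n"
  shows "\<exists>y' z' k l. (y', z') \<in> APS a d n \<and> y = y' + k * d \<and> z = z' + l * d"
  using assms
proof (induction z rule: less_induct)
  case (less z)
  show ?case
  proof (cases "d \<le> z \<and> (y, z - d) \<in> SS a d n")
    case True
    moreover have "z - d < z" using True d_pos by simp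
    ultimately obtain y' z' k l where "(y', z') \<in> APS a d n" "y = y' + k * d" "z - d = z' + l * d"
      using less.IH[of "z - d"] by blast
    then show ?thesis using True
      by (intro exI[of _ y'] exI[of _ z'] exI[of _ k] exI[of _ "Suc l"]) auto
  next
    case False
    then show ?thesis using SS_decompose_an[OF less.prems] by (metis add.right_neutral mult_0)
  qed
qed

end

section \<open>Consequences of the isomorphism of Apery posets\<close>

locale isomorphic_apery = projective_curve +
  assumes iso: "poset_iso (APS a d n) (leS a d n) (Ap1 a d n) (le1 a n)"
begin

lemma finite_APS: "finite (APS a d n)" and card_APS: "card (APS a d n) = card (Ap1 a d n)"
  using iso finite_Ap1 unfolding poset_iso_def by (auto dest: bij_betw_finite bij_betw_same_card)

text \<open>The sets have the same cardinality, so the section of the first projection given by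
  \<open>Ap1_lift\<close> is onto.\<close>

lemma APS_fst_bij: "bij_betw fst (APS a d n) (Ap1 a d n)"
proof -
  obtain z where z: "\<And>y. y \<in> Ap1 a d n \<Longrightarrow> (y, z y) \<in> APS a d n" using Ap1_lift by metis
  let ?f = "\<lambda>y. (y, z y)"
  have inj: "inj_on ?f (Ap1 a d n)" by (auto simp: inj_on_def)
  have "?f ` Ap1 a d n = APS a d n"
    using z card_image[OF inj] card_APS by (intro card_subset_eq[OF finite_APS]) auto
  then have "APS a d n = ?f ` Ap1 a d n" by (rule sym)
  then show ?thesis by (simp only: bij_betw_def) (simp add: inj_on_def image_image)
qed

lemma APS_fst: "(y, z) \<in> APS a d n \<Longrightarrow> y \<in> Ap1 a d n"
  using APS_fst_bij by (force simp: bij_betw_def)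

lemma APS_eqI: "(y, z) \<in> APS a d n \<Longrightarrow> (y, z') \<in> APS a d n \<Longrightarrow> z = z'"
  using APS_fst_bij by (force simp: bij_betw_def inj_on_def)

text \<open>The first projection is an order-preserving bijection between finite posets with the same
  number of comparable pairs, hence an isomorphism.\<close>

lemma leS_of_le1:
  assumes s: "s \<in> APS a d n" and t: "t \<in> APS a d n" and le: "le1 a n (fst s) (fst t)"
  shows "leS a d n s t"
proof -
  define R where "R = {p \<in> APS a d n \<times> APS a d n. leS a d n (fst p) (snd p)}"
  define R1 where "R1 = {p \<in> Ap1 a d n \<times> Ap1 a d n. le1 a n (fst p) (snd p)}"
  have fin: "finite R1" unfolding R1_def using finite_Ap1 by (intro finite_subset[OF _ finite_cartesian_product]) auto
  obtain f where f: "bij_betw f (APS a d n) (Ap1 a d n)"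
    "\<And>x y. x \<in> APS a d n \<Longrightarrow> y \<in> APS a d n \<Longrightarrow> leS a d n x y \<longleftrightarrow> le1 a n (f x) (f y)"
    using iso unfolding poset_iso_def by blast
  have "bij_betw (map_prod f f) R R1"
    unfolding bij_betw_def
  proof
    show "inj_on (map_prod f f) R"
      using f(1) by (auto simp: R_def inj_on_def bij_betw_def)
    show "map_prod f f ` R = R1"
    proof
      show "map_prod f f ` R \<subseteq> R1" using f by (auto simp: R_def R1_def bij_betw_def)
      show "R1 \<subseteq> map_prod f f ` R"
      proof
        fix p assume p: "p \<in> R1"
        then obtain x y where xy: "x \<in> APS a d n" "y \<in> APS a d n" "p = (f x, f y)"
          using bij_betw_imp_surj_on[OF f(1)] unfolding R1_def by blast
        then have "(x, y) \<in> R" using p f(2) by (simp add: R_def R1_def)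
        then show "p \<in> map_prod f f ` R" using xy by force
      qed
    qed
  qed
  then have card: "card R = card R1" by (rule bij_betw_same_card)
  have inj: "inj_on (map_prod fst fst) R"
    by (auto simp: R_def inj_on_def intro: APS_eqI)
  have sub: "map_prod fst fst ` R \<subseteq> R1"
  proof
    fix p assume "p \<in> map_prod fst fst ` R"
    then obtain x y where xy: "x \<in> APS a d n" "y \<in> APS a d n" "leS a d n x y" "p = (fst x, fst y)"
      by (auto simp: R_def)
    then show "p \<in> R1"
      using APS_fst[of "fst x" "snd x"] APS_fst[of "fst y" "snd y"]
      by (auto simp: R1_def leS_def le1_def intro: SS_fst)
  qed
  have "map_prod fst fst ` R = R1"
    using sub card_image[OF inj] card by (intro card_subset_eq[OF fin]) auto
  moreover have "(fst s, fst t) \<in> R1"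
    using s t le APS_fst[of "fst s" "snd s"] APS_fst[of "fst t" "snd t"] by (simp add: R1_def)
  ultimately obtain x y where xy: "(x, y) \<in> R" "fst x = fst s" "fst y = fst t" by force
  then have "x = s" "y = t"
    using s t APS_eqI unfolding R_def by (auto simp: prod_eq_iff) (metis prod.collapse)+
  then show ?thesis using xy(1) by (simp add: R_def)
qed

text \<open>Let \<open>t\<close> be the second coordinate over \<open>y + a i\<close>. Reflection of
  the order gives \<open>(a i, t - z) \<in> SS a d n\<close>, and as a summand of an Apery element
  it is itself in \<open>APS\<close>. The fibre over \<open>a i\<close> has one element, so
  \<open>t - z = d - a i\<close>.\<close>

lemma APS_add_gen:
  assumes "(y, z) \<in> APS a d n" "0 < i" "i < n" "y + a i \<in> Ap1 a d n"
  shows "(y + a i, z + (d - a i)) \<in> APS a d n"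
proof -
  obtain t where t: "(y + a i, t) \<in> APS a d n" using Ap1_lift[OF assms(4)] by blast
  have "le1 a n y (y + a i)" using gen_S1[of i] assms(2,3) by (simp add: le1_def)
  then have le: "z \<le> t" "(a i, t - z) \<in> SS a d n" using leS_of_le1[OF assms(1) t] by (auto simp: leS_def)
  have "(y, z) \<in> SS a d n" using assms(1) by (simp add: APS_def)
  moreover have "(a i + y, (t - z) + z) \<in> APS a d n" using t le(1) by (simp add: add.commute)
  ultimately have "(a i, t - z) \<in> APS a d n" by (rule APS_lower[OF le(2)])
  then have "t - z = d - a i" using APS_eqI gen_APS[OF assms(2,3)] by blast
  then have "z + (d - a i) = t" using le(1) by simp
  then show ?thesis using t by simp
qed

text \<open>Induction on the total degree: splitting off one variable stays inside the down-set
  \<open>Ap1\<close>, and \<open>APS_add_gen\<close> puts the variable back. This is where the order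
  isomorphism enters the comparison of the two ideals.\<close>

lemma monomial_APS:
  assumes "keys m \<subseteq> {1..n} - {n}" "ev a m \<in> Ap1 a d n"
  shows "(ev a m, ev (\<lambda>i. d - a i) m) \<in> APS a d n"
  using assms
proof (induction "ev (\<lambda>_. 1) m" arbitrary: m rule: less_induct)
  case less
  show ?case
  proof (cases "m = 0")
    case True
    then show ?thesis using zero_APS by simp
  next
    case False
    then obtain j where j: "j \<in> keys m" by fastforce
    then have "\<exists>m'. keys m' \<subseteq> {1..n} - {n} \<and> lookup m' j > 0 \<and> m' = m"
      using less.prems(1) by (simp add: in_keys_iff)
    then obtain m' where m': "keys m' \<subseteq> {1..n} - {n}" "m = single j 1 + m'" unfolding ex_monomial_split by blast
    have jn: "0 < j" "j < n" using less.prems(1) j by auto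
    have "ev a m' \<in> S1 a n" unfolding S1_iff using m'(1) by blast
    moreover have "ev a m = ev a m' + a j" by (simp add: m'(2) ev_plus)
    ultimately have "ev a m' \<in> Ap1 a d n" using less.prems(2) Ap1_lower[OF _ gen_S1[of j]] jn by simp
    moreover have "ev (\<lambda>_. 1) m' < ev (\<lambda>_. 1) m" by (simp add: m'(2) ev_plus)
    ultimately have "(ev a m', ev (\<lambda>i. d - a i) m') \<in> APS a d n" using less.hyps m'(1) by blast
    from APS_add_gen[OF this jn] show ?thesis
      using less.prems(2) by (simp add: m'(2) ev_plus add.commute)
  qed
qed

text \<open>This is the Cohen--Macaulay property of the semigroup.\<close>

lemma SS_cohen_macaulay:
  assumes s: "(y, z) \<in> SS a d n" and not: "\<not> (d \<le> z \<and> (y, z - d) \<in> SS a d n)"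
  shows "\<not> (d \<le> z \<and> (y + d, z - d) \<in> SS a d n)"
proof
  assume *: "d \<le> z \<and> (y + d, z - d) \<in> SS a d n"
  obtain y' k where 1: "(y', z) \<in> APS a d n" "y = y' + k * d" using SS_decompose_an[OF s not] by blast
  obtain u t k' l where 2: "(u, t) \<in> APS a d n" "y + d = u + k' * d" "z - d = t + l * d"
    using * SS_decompose by metis
  \<comment> \<open>Moving by \<open>(d, 0)\<close> does not change the first coordinate modulo
    \<open>d\<close>, so both decompositions have the same Apery element and hence the same second
    coordinate \<open>z\<close>; but the second one is at most \<open>z - d\<close>.\<close>
  have "y' + Suc k * d = u + k' * d" using 1 2 by simp
  then have "y' = u" using Ap1_residue_unique[OF APS_fst[OF 1(1)] APS_fst[OF 2(1)]] by blast
  then have "t = z" using APS_eqI 1(1) 2(1) by blast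
  then have "z \<le> z - d" using 2(3) by simp
  then show False using * d_pos by linarith
qed

section \<open>Fibres lost when \<open>x_0\<close> and \<open>x_n\<close> are set to zero\<close>

lemma hit_iff:
  assumes "x \<le> n"
  shows "(\<exists>m. keys m \<subseteq> {0..n} \<and> lookup m x > 0 \<and> mon_img a d m = mon_img a d m0) \<longleftrightarrow>
    a x \<le> ev a m0 \<and> d - a x \<le> ev (\<lambda>i. d - a i) m0 \<and>
    (ev a m0 - a x, ev (\<lambda>i. d - a i) m0 - (d - a x)) \<in> SS a d n"
proof -
  let ?b = "\<lambda>i. d - a i"
  have "(\<exists>m. keys m \<subseteq> {0..n} \<and> lookup m x > 0 \<and> mon_img a d m = mon_img a d m0) \<longleftrightarrow>
    (\<exists>m. keys m \<subseteq> {0..n} \<and> a x + ev a m = ev a m0 \<and> ?b x + ev ?b m = ev ?b m0)"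
    using assms by (simp add: ex_monomial_split mon_img_eq_iff ev_plus)
  also have "\<dots> \<longleftrightarrow> a x \<le> ev a m0 \<and> ?b x \<le> ev ?b m0 \<and>
    (\<exists>m. keys m \<subseteq> {0..n} \<and> ev a m0 - a x = ev a m \<and> ev ?b m0 - ?b x = ev ?b m)"
    (is "?L \<longleftrightarrow> ?R")
  proof
    show "?L \<Longrightarrow> ?R" by (elim exE conjE) (metis diff_add_inverse le_add1)
    show "?R \<Longrightarrow> ?L" by (elim exE conjE) (metis le_add_diff_inverse)
  qed
  finally show ?thesis unfolding SS_iff .
qed

lemma hit0_iff:
  "(\<exists>m. keys m \<subseteq> {0..n} \<and> lookup m 0 > 0 \<and> mon_img a d m = mon_img a d m0) \<longleftrightarrow>
    d \<le> ev (\<lambda>i. d - a i) m0 \<and> (ev a m0, ev (\<lambda>i. d - a i) m0 - d) \<in> SS a d n"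
  using hit_iff[of 0 m0] by (simp add: a0)

lemma hitn_iff:
  "(\<exists>m. keys m \<subseteq> {0..n} \<and> lookup m n > 0 \<and> mon_img a d m = mon_img a d m0) \<longleftrightarrow>
    d \<le> ev a m0 \<and> (ev a m0 - d, ev (\<lambda>i. d - a i) m0) \<in> SS a d n"
  using hit_iff[of n m0] by (simp add: an)

lemma hit1_iff:
  "(\<exists>m. keys m \<subseteq> {1..n} \<and> lookup m n > 0 \<and> mon_img1 a m = mon_img1 a m0) \<longleftrightarrow>
    d \<le> ev a m0 \<and> ev a m0 - d \<in> S1 a n"
proof -
  have "(\<exists>m. keys m \<subseteq> {1..n} \<and> lookup m n > 0 \<and> mon_img1 a m = mon_img1 a m0) \<longleftrightarrow>
    (\<exists>m. keys m \<subseteq> {1..n} \<and> d + ev a m = ev a m0)"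
    using n_pos by (simp add: ex_monomial_split mon_img1_eq_iff ev_plus an)
  also have "\<dots> \<longleftrightarrow> d \<le> ev a m0 \<and> (\<exists>m. keys m \<subseteq> {1..n} \<and> ev a m0 - d = ev a m)"
    (is "?L \<longleftrightarrow> ?R")
  proof
    show "?L \<Longrightarrow> ?R" by (elim exE conjE) (metis diff_add_inverse le_add1)
    show "?R \<Longrightarrow> ?L" by (elim exE conjE) (metis le_add_diff_inverse)
  qed
  finally show ?thesis unfolding S1_iff .
qed

text \<open>\<open>B1\<close> records the conditions that survive \<open>x_0 = 0\<close> in the
  projective ideal, \<open>B2\<close> those that survive \<open>x_n = 0\<close> afterwards, and
  \<open>B3\<close> those that survive \<open>x_n = 0\<close> in the affine ideal. The shape of each
  follows \<open>rho_fib\<close>.\<close>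

definition B1 :: "(nat \<Rightarrow>\<^sub>0 nat) set" where
  "B1 = {\<mu>\<in>UNIV. \<not> (\<exists>m. keys m \<subseteq> {0..n} \<and> lookup m 0 > 0 \<and> mon_img a d m = \<mu>)}"

definition B2 :: "(nat \<Rightarrow>\<^sub>0 nat) set" where
  "B2 = {\<mu>\<in>B1. \<not> (\<exists>m. keys m \<subseteq> {1..n} \<and> lookup m n > 0 \<and> mon_img a d m = \<mu>)}"

definition B3 :: "(nat \<Rightarrow>\<^sub>0 nat) set" where
  "B3 = {\<mu>\<in>UNIV. \<not> (\<exists>m. keys m \<subseteq> {1..n} \<and> lookup m n > 0 \<and> mon_img1 a m = \<mu>)}"

lemma mon_SS: "keys m \<subseteq> {1..n} \<Longrightarrow> (ev a m, ev (\<lambda>i. d - a i) m) \<in> SS a d n"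
  unfolding SS_iff by (intro exI[of _ m]) auto

lemma B1_iff: "mon_img a d m \<in> B1 \<longleftrightarrow>
    \<not> (d \<le> ev (\<lambda>i. d - a i) m \<and> (ev a m, ev (\<lambda>i. d - a i) m - d) \<in> SS a d n)"
  unfolding hit0_iff[symmetric] B1_def by blast

text \<open>The definition of \<open>B2\<close> tests only monomials without \<open>x_0\<close>,
  whereas \<open>APS\<close> refers to the full semigroup. On \<open>B1\<close> the tests agree,
  since a monomial involving \<open>x_0\<close> in the fibre would already have removed it.\<close>

lemma B2_iff:
  assumes "keys m \<subseteq> {1..n}"
  shows "mon_img a d m \<in> B2 \<longleftrightarrow> (ev a m, ev (\<lambda>i. d - a i) m) \<in> APS a d n"
proof -
  have hit: "(\<exists>m'. keys m' \<subseteq> {1..n} \<and> lookup m' n > 0 \<and> mon_img a d m' = mon_img a d m) \<longleftrightarrow>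
    (\<exists>m'. keys m' \<subseteq> {0..n} \<and> lookup m' n > 0 \<and> mon_img a d m' = mon_img a d m)" (is "?L \<longleftrightarrow> ?R")
    if "mon_img a d m \<in> B1"
  proof
    assume ?R
    then obtain m' where m': "keys m' \<subseteq> {0..n}" "lookup m' n > 0" "mon_img a d m' = mon_img a d m" by blast
    have nh: "\<not> (\<exists>m'. keys m' \<subseteq> {0..n} \<and> lookup m' 0 > 0 \<and> mon_img a d m' = mon_img a d m)"
      using that unfolding B1_def by (elim CollectE conjE)
    have "0 \<notin> keys m'"
    proof
      assume "0 \<in> keys m'"
      then have "lookup m' 0 > 0" by (simp add: in_keys_iff)
      with m'(1,3) have "\<exists>m'. keys m' \<subseteq> {0..n} \<and> lookup m' 0 > 0 \<and> mon_img a d m' = mon_img a d m"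
        by (intro exI[of _ m'] conjI)
      with nh show False by (rule notE)
    qed
    then have "keys m' \<subseteq> {0..n} - {0}" using m'(1) by blast
    also have "\<dots> = {1..n}" by auto
    finally show ?L using m'(2,3) by (intro exI[of _ m'] conjI)
  next
    have *: "{1..n} \<subseteq> {0..n}" by auto
    assume ?L
    then show ?R by (elim exE conjE) (intro exI conjI order_trans[OF _ *])
  qed
  have "mon_img a d m \<in> B2 \<longleftrightarrow> mon_img a d m \<in> B1 \<and>
      \<not> (d \<le> ev a m \<and> (ev a m - d, ev (\<lambda>i. d - a i) m) \<in> SS a d n)"
    unfolding B2_def mem_Collect_eq using hit[unfolded hitn_iff] by (rule conj_cong[OF refl arg_cong[of _ _ Not]])
  then show ?thesis
    unfolding B1_iff APS_def using mon_SS[OF assms] by simp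
qed

lemma B3_iff:
  assumes "keys m \<subseteq> {1..n}"
  shows "mon_img1 a m \<in> B3 \<longleftrightarrow> ev a m \<in> Ap1 a d n"
proof -
  have "ev a m \<in> S1 a n" unfolding S1_iff using assms by blast
  then show ?thesis using hit1_iff[of m] by (auto simp: B3_def Ap1_def)
qed

text \<open>Passing from \<open>APS\<close> to \<open>Ap1\<close> is projection; the converse for
  monomials in the middle variables is \<open>monomial_APS\<close>. Monomials with the same first
  coordinate in \<open>Ap1\<close> have the same second one by \<open>APS_eqI\<close>, so the fibres
  coincide.\<close>

lemma fib_B2_eq_B3:
  "fib ({1..n} - {n}) (mon_img a d) B2 = fib ({1..n} - {n}) (mon_img1 a) B3"
proof -
  let ?W = "{1..n} - {n}"
  have W: "keys m \<subseteq> {1..n}" if "keys m \<subseteq> ?W" for m :: "nat \<Rightarrow>\<^sub>0 nat" using that by blast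
  have iff: "mon_img a d m \<in> B2 \<longleftrightarrow> mon_img1 a m \<in> B3" if "keys m \<subseteq> ?W" for m
    unfolding B2_iff[OF W[OF that]] B3_iff[OF W[OF that]]
    using monomial_APS[OF that] APS_fst by blast
  have eq: "mon_img a d m' = mon_img a d m \<longleftrightarrow> mon_img1 a m' = mon_img1 a m"
    if m: "keys m \<subseteq> ?W" "keys m' \<subseteq> ?W" "mon_img1 a m \<in> B3" for m m'
  proof
    assume "mon_img1 a m' = mon_img1 a m"
    then have ev: "ev a m' = ev a m" by (simp add: mon_img1_eq_iff)
    have Ap: "ev a m \<in> Ap1 a d n" using m(3) B3_iff[OF W[OF m(1)]] by simp
    then have "(ev a m, ev (\<lambda>i. d - a i) m) \<in> APS a d n" "(ev a m, ev (\<lambda>i. d - a i) m') \<in> APS a d n"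
      using monomial_APS[OF m(1)] monomial_APS[OF m(2)] ev by auto
    then show "mon_img a d m' = mon_img a d m" using APS_eqI ev by (simp add: mon_img_eq_iff)
  qed (simp add: mon_img_eq_iff mon_img1_eq_iff)
  show ?thesis
  proof
    show "fib ?W (mon_img a d) B2 \<subseteq> fib ?W (mon_img1 a) B3"
      by (rule fib_subset) (use iff eq in blast)+
    show "fib ?W (mon_img1 a) B3 \<subseteq> fib ?W (mon_img a d) B2"
      by (rule fib_subset) (use iff eq in blast)+
  qed
qed

section \<open>Gradings of the toric ideals and equality of Betti numbers\<close>

lemma ev_eq_zeroD:
  assumes "ev f m = 0" "\<And>j. j \<in> keys m \<Longrightarrow> f j > 0"
  shows "m = 0"
proof (rule ccontr)
  assume "m \<noteq> 0"
  then obtain j where j: "j \<in> keys m" by fastforce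
  have "lookup m j * f j \<le> ev f m" unfolding ev_def by (rule member_le_sum[OF j]) auto
  then show False using assms(1) assms(2)[OF j] j by (simp add: in_keys_iff)
qed

lemma graded_ideal_toric: "graded_ideal (\<lambda>_. 1) {0..n} (toric_ideal a d n :: 'k::field mpoly set)"
  unfolding toric_ideal_fib
proof (rule graded_ideal_fib)
  \<comment> \<open>Each generator has coordinate sum \<open>d\<close>, so the standard degree is
    the coordinate sum of the image divided by \<open>d\<close>.\<close>
  have sum: "ev a m + ev (\<lambda>i. d - a i) m = d * ev (\<lambda>_. 1) m" if "keys m \<subseteq> {0..n}" for m
  proof -
    have "a j \<le> d" if "j \<in> keys m" for j
    proof -
      have "j \<le> n" using \<open>keys m \<subseteq> {0..n}\<close> that by auto
      then show ?thesis using a_less[of j] an by (cases "j = n") auto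
    qed
    then show ?thesis
      unfolding ev_def sum_distrib_left sum.distrib[symmetric]
      by (intro sum.cong refl) (simp add: distrib_left[symmetric])
  qed
  show "wdeg (\<lambda>_. 1) m = int ((lookup (mon_img a d m) 0 + lookup (mon_img a d m) 1) div d)"
    if "keys m \<subseteq> {0..n}" for m
    using sum[OF that] d_pos by (simp add: mon_img_ev lookup_add lookup_single wdeg_ev)
  show "m = 0" if "keys m \<subseteq> {0..n}" "mon_img a d m = mon_img a d 0" for m
    using sum[OF that(1)] that(2) d_pos by (intro ev_eq_zeroD[of "\<lambda>_. 1"]) (auto simp: mon_img_eq_iff)
qed (rule mon_img_add)

lemma graded_ideal_toric1: "graded_ideal a {1..n} (toric_ideal1 a n :: 'k::field mpoly set)"
  unfolding toric_ideal1_fib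
proof (rule graded_ideal_fib)
  show "wdeg a m = int (lookup (mon_img1 a m) 0)" for m
    by (simp add: mon_img1_ev wdeg_ev)
  show "m = 0" if "keys m \<subseteq> {1..n}" "mon_img1 a m = mon_img1 a 0" for m
    using that by (intro ev_eq_zeroD[of a m]) (auto simp: mon_img1_eq_iff intro!: a_pos)
qed (rule mon_img1_add)

theorem betti_eq:
  "betti (\<lambda>_. 1) {0..n} (toric_ideal a d n :: 'k::field mpoly set) i =
   betti a {1..n} (toric_ideal1 a n :: 'k mpoly set) i"
proof -
  let ?I = "toric_ideal a d n :: 'k mpoly set" and ?J = "toric_ideal1 a n :: 'k mpoly set"
  have I: "is_ideal {0..n} ?I" and J: "is_ideal {1..n} ?J"
    using graded_ideal_toric graded_ideal_toric1 by (auto simp: graded_ideal_def)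
  obtain b sh e \<delta> where F: "min_graded_free_res (\<lambda>_. 1) {0..n} ?I b sh e \<delta>"
    using min_graded_free_res_exists[OF _ _ graded_ideal_toric] by auto
  obtain b' sh' e' \<delta>' where F': "min_graded_free_res a {1..n} ?J b' sh' e' \<delta>'"
    using min_graded_free_res_exists[OF _ _ graded_ideal_toric1] a_pos by auto
  have 1: "{0..n} - {0} = {1..n}" by auto
  have rI: "rho 0 ` ?I = fib {1..n} (mon_img a d) B1"
    unfolding toric_ideal_fib rho_fib 1 B1_def by simp
  have rrI: "rho n ` rho 0 ` ?I = fib ({1..n} - {n}) (mon_img a d) B2"
    unfolding rI rho_fib B2_def by simp
  have rJ: "rho n ` ?J = fib ({1..n} - {n}) (mon_img1 a) B3"
    unfolding toric_ideal1_fib rho_fib B3_def by simp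
  have R1: "min_free_res {1..n} (rho 0 ` ?I) b (\<lambda>j. rho 0 (e j)) (\<lambda>i r c. rho 0 (\<delta> i r c))"
    unfolding 1[symmetric]
  proof (rule min_free_res_mod_var[OF I])
    show "min_free_res {0..n} ?I b e \<delta>" using F by (rule min_free_res_of_graded)
    \<comment> \<open>No fibre condition has been removed yet: the surviving set is
      \<open>UNIV\<close>, which is stable under any translation.\<close>
    show "f \<in> ?I" if "f \<in> Pring {0..n}" "var 0 * f \<in> ?I" for f
      unfolding toric_ideal_fib
      by (rule fib_nonzerodivisor[OF mon_img_add UNIV_I that[unfolded toric_ideal_fib]])
  qed simp
  have R2: "min_free_res ({1..n} - {n}) (rho n ` rho 0 ` ?I) b
      (\<lambda>j. rho n (rho 0 (e j))) (\<lambda>i r c. rho n (rho 0 (\<delta> i r c)))"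
  proof (rule min_free_res_mod_var[OF _ _ _ R1])
    show "is_ideal {1..n} (rho 0 ` ?I)" using is_ideal_rho[OF I, of 0] unfolding 1 .
    show "f \<in> rho 0 ` ?I" if f: "f \<in> Pring {1..n}" "var n * f \<in> rho 0 ` ?I" for f
    proof -
      \<comment> \<open>Stability of \<open>B1\<close> under translation by \<open>(d, 0)\<close> is
        exactly \<open>SS_cohen_macaulay\<close>; it makes \<open>x_n\<close> regular after
        \<open>x_0\<close> has been set to zero.\<close>
      have B1: "mon_img a d (single n 1) + mon_img a d m \<in> B1" if "keys m \<subseteq> {1..n}" "mon_img a d m \<in> B1" for m
        using SS_cohen_macaulay[OF mon_SS[OF that(1)]] that(2)
        unfolding mon_img_add[symmetric] B1_iff by (simp add: ev_plus an add.commute)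
      show ?thesis
        unfolding rI by (rule fib_nonzerodivisor[OF mon_img_add B1 f[unfolded rI]])
    qed
  qed (use n_pos in auto)
  have R3: "min_free_res ({1..n} - {n}) (rho n ` ?J) b' (\<lambda>j. rho n (e' j)) (\<lambda>i r c. rho n (\<delta>' i r c))"
  proof (rule min_free_res_mod_var[OF J])
    show "min_free_res {1..n} ?J b' e' \<delta>'" using F' by (rule min_free_res_of_graded)
    show "f \<in> ?J" if "f \<in> Pring {1..n}" "var n * f \<in> ?J" for f
      unfolding toric_ideal1_fib
      by (rule fib_nonzerodivisor[OF mon_img1_add UNIV_I that[unfolded toric_ideal1_fib]])
  qed (use n_pos in auto)
  \<comment> \<open>By \<open>fib_B2_eq_B3\<close>, \<open>R2\<close> and \<open>R3\<close> resolve
    the same ideal, and both reductions kept the ranks of the original resolutions.\<close>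
  have "b = b'"
    by (rule min_free_res_rank_unique[OF is_ideal_rho[OF J, of n] _ R3])
      (use R2 in \<open>simp only: rrI rJ fib_B2_eq_B3\<close>)
  then show ?thesis using betti_eq_rank[OF I F] betti_eq_rank[OF J F'] by simp
qed

end

theorem mainTheorem4:
  fixes a :: "nat \<Rightarrow> nat" and d n :: nat
  assumes k_inf: "infinite (UNIV :: 'k::field set)"
    and d_pos: "d \<ge> 1"
    and a0: "a 0 = 0"
    and an: "a n = d"
    and a_mono: "\<And>i j. i < j \<Longrightarrow> j \<le> n \<Longrightarrow> a i < a j"
    and a_gcd: "Gcd (a ` {1..n}) = 1"
    and iso: "poset_iso (APS a d n) (leS a d n) (Ap1 a d n) (le1 a n)"
  shows "\<forall>i. betti (\<lambda>_. 1) {0..n} (toric_ideal a d n :: 'k mpoly set) i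
             = betti a {1..n} (toric_ideal1 a n :: 'k mpoly set) i"
proof -
  interpret isomorphic_apery a d n
    using d_pos a0 an a_mono iso by unfold_locales
  show ?thesis using betti_eq by blast
qed

end
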